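(* As functions of $x$ and $q$ (with $|q|<1$), $$2x\frac{(q^2;q^2)_\infty^2}{(-q;q^2)_\infty}[C^*(x;q^2)]^3J(-xq;q^2)=2\delta_qN^*+\delta_xN^*+\delta_x^2N^*,$$ where $N^*=N^*(0,1/q,x;q^2)$, and $$2x\frac{(q^2;q^2)_\infty^2}{(-q;q^2)_\infty}[C(x;q^2)]^3J(-xq;q^2)=2(1-x)^2\delta_qN+(1+x)(1-x)\delta_xN+2xN+(1-x)^2\delta_x^2N,$$ where $N=N(0,1/q,x;q^2)$.
   Context: $(a_1,\dots,a_j;p)_\infty=\prod_{t\ge0}\prod_i(1-a_ip^t)$, $(a_1,\dots,a_j;p)_n=(a_1,\dots,a_j;p)_\infty/(a_1p^n,\dots,a_jp^n;p)_\infty$. $N(0,1/q,x;q^2):=\sum_{n\ge0}\frac{q^{n^2}(-q;q^2)_n}{(xq^2,q^2/x;q^2)_n}$, $N^*(0,1/q,x;q^2):=N(0,1/q,x;q^2)/(1-x)$. $C(x;q^2):=\frac{(q^2;q^2)_\infty}{(xq^2,q^2/x;q^2)_\infty}$, $C^*(x;q^2):=C(x;q^2)/(1-x)$, $J(-xq;q^2):=(-xq,-q/x;q^2)_\infty$. $\delta_q:=q\frac{\partial}{\partial q}$, $\delta_x:=x\frac{\partial}{\partial x}$; a product like $(1-x)^2\delta_x^2N$ means multiplication after differentiation. *)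

theory Defs
  imports "HOL-Analysis.Analysis"
begin

definition qpoch_inf :: "complex list \<Rightarrow> complex \<Rightarrow> complex" where
  "qpoch_inf as p = (\<Prod>t. \<Prod>a\<leftarrow>as. (1 - a * p ^ t))"

definition qpoch :: "complex list \<Rightarrow> complex \<Rightarrow> nat \<Rightarrow> complex" where
  "qpoch as p n = qpoch_inf as p / qpoch_inf (map (\<lambda>a. a * p ^ n) as) p"

(* rank_N x q is N(0,1/q,x;q^2), as a function of q itself (not of the base q^2);
   it makes sense at q = 0 too, since 1/q does not occur in the series. *)
definition rank_N :: "complex \<Rightarrow> complex \<Rightarrow> complex" where
  "rank_N x q = (\<Sum>n. q ^ (n\<^sup>2) * qpoch [- q] (q\<^sup>2) n / qpoch [x * q\<^sup>2, q\<^sup>2 / x] (q\<^sup>2) n)"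

definition rank_N_star :: "complex \<Rightarrow> complex \<Rightarrow> complex" where
  "rank_N_star x q = rank_N x q / (1 - x)"

(* crank_C x p is C(x;p) with base p; the theorem uses p = q^2. *)
definition crank_C :: "complex \<Rightarrow> complex \<Rightarrow> complex" where
  "crank_C x p = qpoch_inf [p] p / qpoch_inf [x * p, p / x] p"

definition crank_C_star :: "complex \<Rightarrow> complex \<Rightarrow> complex" where
  "crank_C_star x p = crank_C x p / (1 - x)"

(* J(z;p) = (z, p/z; p)_inf. For z = -xq and p = q^2 the second parameter is -q/x;
   this holds at q = 0 as well because 0/0 = 0. *)
definition theta_J :: "complex \<Rightarrow> complex \<Rightarrow> complex" where
  "theta_J z p = qpoch_inf [z, p / z] p"

(* The operator z d/dz. Partial operators in one of two variables are obtained by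
   applying it to a section of the function. *)
definition euler_op :: "(complex \<Rightarrow> complex) \<Rightarrow> complex \<Rightarrow> complex" where
  "euler_op f = (\<lambda>z. z * deriv f z)"

definition delta_q :: "(complex \<Rightarrow> complex \<Rightarrow> complex) \<Rightarrow> complex \<Rightarrow> complex \<Rightarrow> complex" where
  "delta_q F = (\<lambda>x q. euler_op (\<lambda>s. F x s) q)"

definition delta_x :: "(complex \<Rightarrow> complex \<Rightarrow> complex) \<Rightarrow> complex \<Rightarrow> complex \<Rightarrow> complex" where
  "delta_x F = (\<lambda>x q. euler_op (\<lambda>y. F y q) x)"

end

theory Submission
  imports Defs "HOL-Complex_Analysis.Complex_Analysis"
begin

text \<open>Write \<open>N\<^sup>*\<close> for the normalised rank function and \<open>P = 2\<delta>\<^sub>q + \<delta>\<^sub>x + \<delta>\<^sub>x\<^sup>2\<close>. Termwise telescoping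
  of the defining series gives the functional equation
  \<open>N\<^sup>*(xq\<^sup>2) = - q x\<^sup>2 N\<^sup>*(x) - q x + 1\<close>. Applying \<open>P\<close> removes the inhomogeneous part, so that \<open>P N\<^sup>*\<close> and
  the product side have the same multiplier \<open>- q x\<^sup>2\<close> under \<open>x \<mapsto> xq\<^sup>2\<close>. Both have a triple pole at
  \<open>x = 1\<close>, with equal leading coefficients by a limiting case of the \<open>q\<close>-Gauss sum. Their difference
  times the square of \<open>(x, q\<^sup>2/x; q\<^sup>2)\<^sub>\<infinity>\<close> is therefore holomorphic with constant multiplier \<open>- q\<close>, and
  such a function vanishes.\<close>

section \<open>Infinite products\<close>

text \<open>The shift x -> xq^2 itself depends on q, so differentiating the functional equation in q
  needs a chain rule in two variables. For this the series is shown to be locally bounded and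
  separately holomorphic in (x, q); the same facts make the q-derivative holomorphic in x. All poles
  of N* lie on the single orbit of x = 1 under the shift, so one pole decides everything. Matching
  its whole principal part would require three coefficients. The squared theta function avoids this:
  its multiplier x^(-2) cancels the x^2 in -q x^2, and its double zero at x = 1 absorbs the two
  lower orders, so only the leading coefficient has to be known. The constant multiplier -q leaves
  no room for a nonzero function: a Laurent coefficient of index n would require q^(2n) = -q, which
  is impossible because the moduli of the two sides are different powers of |q| < 1. The shift
  argument needs q to be nonzero; at q = 0 the identity is checked directly.\<close>

definition qfac :: "complex \<Rightarrow> complex \<Rightarrow> nat \<Rightarrow> complex" where
  "qfac a p n = (\<Prod>k<n. 1 - a * p ^ k)"

definition qinf :: "complex \<Rightarrow> complex \<Rightarrow> complex" where
  "qinf a p = (\<Prod>k. 1 - a * p ^ k)"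

lemma qfac_0 [simp]: "qfac a p 0 = 1"
  by (simp add: qfac_def)

lemma qfac_Suc: "qfac a p (Suc n) = qfac a p n * (1 - a * p ^ n)"
  by (simp add: qfac_def)

lemma qfac_shift: "(1 - a) * qfac (a * p) p n = qfac a p n * (1 - a * p ^ n)"
proof -
  have "qfac a p (Suc n) = (1 - a) * qfac (a * p) p n"
    unfolding qfac_def prod.lessThan_Suc_shift by (simp add: mult.assoc)
  thus ?thesis by (simp add: qfac_Suc)
qed

lemma convergent_prod_qinf:
  fixes a p :: complex
  assumes "norm p < 1"
  shows "convergent_prod (\<lambda>k. 1 - a * p ^ k)"
proof -
  have "summable (\<lambda>k. norm a * norm p ^ k)"
    using assms by (intro summable_mult summable_geometric) auto
  hence "abs_convergent_prod (\<lambda>k. 1 - a * p ^ k)"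
    by (intro summable_imp_abs_convergent_prod) (simp add: norm_mult norm_power)
  thus ?thesis by (rule abs_convergent_prod_imp_convergent_prod)
qed

lemma qinf_split:
  assumes "norm p < 1"
  shows "qinf a p = qfac a p n * qinf (a * p ^ n) p"
  using has_prod_ignore_initial_segment'[OF convergent_prod_qinf[OF assms, of a], of n]
  by (simp add: has_prod_iff qinf_def qfac_def power_add mult_ac)

lemma qinf_head:
  assumes "norm p < 1"
  shows "qinf a p = (1 - a) * qinf (a * p) p"
  using qinf_split[OF assms, of a 1] by (simp add: qfac_Suc)

lemma qinf_nonzero:
  assumes "norm p < 1" "\<And>k. a * p ^ k \<noteq> 1"
  shows "qinf a p \<noteq> 0"
  unfolding qinf_def
  by (rule prodinf_nonzero[OF convergent_prod_qinf[OF assms(1)]]) (metis assms(2) eq_iff_diff_eq_0)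

lemma power_mult_ne_1:
  fixes a p :: complex
  assumes "norm p < 1" "norm a < 1"
  shows "a * p ^ k \<noteq> 1"
proof
  assume "a * p ^ k = 1"
  hence "norm a * norm p ^ k = 1" by (metis norm_mult norm_one norm_power)
  moreover have "norm a * norm p ^ k \<le> norm a * 1"
    using assms by (intro mult_left_mono power_le_one) auto
  ultimately show False using assms by simp
qed

lemma qinf_nonzero_norm:
  assumes "norm p < 1" "norm a < 1"
  shows "qinf a p \<noteq> 0"
  using assms power_mult_ne_1 by (intro qinf_nonzero) auto

section \<open>Passage from \<open>qpoch_inf\<close> and \<open>qpoch\<close> to plain
  products\<close>

lemma qpoch_inf_single: "qpoch_inf [a] p = qinf a p"
  by (simp add: qpoch_inf_def qinf_def)

lemma qpoch_inf_pair:
  assumes "norm p < 1"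
  shows "qpoch_inf [a, b] p = qinf a p * qinf b p"
  using prodinf_mult[OF convergent_prod_qinf[OF assms, of a] convergent_prod_qinf[OF assms, of b]]
  by (simp add: qpoch_inf_def qinf_def)

text \<open>The condition on all k keeps the tail product in the denominator of the quotient
  definition nonzero, so that the quotient really is the finite product.\<close>

lemma qpoch_single:
  assumes "norm p < 1" "\<And>k. a * p ^ k \<noteq> 1"
  shows "qpoch [a] p n = qfac a p n"
proof -
  have "qinf (a * p ^ n) p \<noteq> 0"
    using assms by (intro qinf_nonzero) (auto simp: mult.assoc simp flip: power_add)
  thus ?thesis
    using qinf_split[OF assms(1), of a n] by (simp add: qpoch_def qpoch_inf_single)
qed

lemma qpoch_pair:
  assumes "norm p < 1" "\<And>k. a * p ^ k \<noteq> 1" "\<And>k. b * p ^ k \<noteq> 1"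
  shows "qpoch [a, b] p n = qfac a p n * qfac b p n"
proof -
  have "qinf (a * p ^ n) p \<noteq> 0" "qinf (b * p ^ n) p \<noteq> 0"
    using assms by (intro qinf_nonzero; simp add: mult.assoc flip: power_add)+
  thus ?thesis
    using qinf_split[OF assms(1), of a n] qinf_split[OF assms(1), of b n]
    by (simp add: qpoch_def qpoch_inf_pair assms(1))
qed

lemma qfac_LIMSEQ:
  assumes "norm p < 1"
  shows "qfac a p \<longlonglongrightarrow> qinf a p"
proof -
  have "(\<lambda>n. qfac a p (Suc n)) \<longlonglongrightarrow> qinf a p"
    using convergent_prod_LIMSEQ[OF convergent_prod_qinf[OF assms, of a]]
    by (simp add: qfac_def qinf_def lessThan_Suc_atMost)
  thus ?thesis by (rule LIMSEQ_imp_Suc)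
qed

lemma holomorphic_qinf:
  assumes p: "norm p < 1"
  shows "(\<lambda>a. qinf a p) holomorphic_on UNIV"
proof (rule holomorphic_uniform_sequence[where f = "\<lambda>n a. qfac a p n"])
  show "(\<lambda>a. qfac a p n) holomorphic_on UNIV" for n
    unfolding qfac_def by (intro holomorphic_intros)
  fix x :: complex
  have "uniformly_convergent_on (cball x 1) (\<lambda>n a. \<Prod>k<n. 1 - a * p ^ k)"
  proof (rule uniformly_convergent_on_prod')
    have "uniform_limit (cball x 1) (\<lambda>n a. \<Sum>k<n. norm ((1 - a * p ^ k) - 1))
        (\<lambda>a. \<Sum>k. norm ((1 - a * p ^ k) - 1)) sequentially"
    proof (rule Weierstrass_m_test)
      show "summable (\<lambda>k. (norm x + 1) * norm p ^ k)"
        using p by (intro summable_mult summable_geometric) auto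
      fix n a assume "a \<in> cball x 1"
      hence "norm a \<le> norm x + 1"
        using norm_triangle_ineq2[of a x] by (simp add: dist_norm norm_minus_commute)
      thus "norm (norm (1 - a * p ^ n - 1)) \<le> (norm x + 1) * norm p ^ n"
        by (simp add: norm_mult norm_power mult_right_mono)
    qed
    thus "uniformly_convergent_on (cball x 1) (\<lambda>n a. \<Sum>k<n. norm ((1 - a * p ^ k) - 1))"
      by (rule uniformly_convergentI)
  qed (auto intro!: continuous_intros)
  hence "uniform_limit (cball x 1) (\<lambda>n a. qfac a p n) (\<lambda>a. lim (\<lambda>n. qfac a p n)) sequentially"
    unfolding qfac_def by (simp add: uniformly_convergent_uniform_limit_iff)
  moreover have "lim (\<lambda>n. qfac a p n) = qinf a p" for a
    using qfac_LIMSEQ[OF p, of a] by (rule limI)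
  ultimately show "\<exists>d. 0 < d \<and> cball x d \<subseteq> UNIV \<and>
      uniform_limit (cball x d) (\<lambda>n a. qfac a p n) (\<lambda>a. qinf a p) sequentially"
    by (intro exI[of _ 1]) simp
qed auto

lemma holomorphic_qinf_comp [holomorphic_intros]:
  assumes "norm p < 1" "f holomorphic_on S"
  shows "(\<lambda>x. qinf (f x) p) holomorphic_on S"
  using holomorphic_on_compose_gen[OF assms(2) holomorphic_qinf[OF assms(1)]]
  by (simp add: o_def)

section \<open>Local bounds for the rank series\<close>

text \<open>The point x = 1 stays in the domain: N is regular there although N* has a pole, and its
  value there is the leading coefficient to be matched. The index \<open>Suc k\<close> leaves out
  exactly the exponent 0.\<close>

definition rank_dom :: "(complex \<times> complex) set" where
  "rank_dom = {(x, s). norm s < 1 \<and> x \<noteq> 0 \<and> (\<forall>k. x * s ^ (2 * Suc k) \<noteq> 1 \<and> s ^ (2 * Suc k) / x \<noteq> 1)}"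

lemma rank_domD:
  assumes "(x, s) \<in> rank_dom"
  shows "norm s < 1" "x \<noteq> 0" "1 - x * s ^ (2 * Suc k) \<noteq> 0" "1 - s ^ (2 * Suc k) / x \<noteq> 0"
proof -
  have *: "norm s < 1" "x \<noteq> 0" "x * s ^ (2 * Suc k) \<noteq> 1" "s ^ (2 * Suc k) / x \<noteq> 1"
    using assms unfolding rank_dom_def by blast+
  thus "norm s < 1" "x \<noteq> 0" by blast+
  show "1 - x * s ^ (2 * Suc k) \<noteq> 0" "1 - s ^ (2 * Suc k) / x \<noteq> 0"
    using *(3,4) by (metis eq_iff_diff_eq_0)+
qed

definition rank_term :: "nat \<Rightarrow> complex \<Rightarrow> complex \<Rightarrow> complex" where
  "rank_term n x s = s ^ n\<^sup>2 * qfac (- s) (s\<^sup>2) n / (qfac (x * s\<^sup>2) (s\<^sup>2) n * qfac (s\<^sup>2 / x) (s\<^sup>2) n)"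

lemma rank_term_0 [simp]: "rank_term 0 x s = 1"
  by (simp add: rank_term_def)

lemma rank_term_Suc:
  "rank_term (Suc n) x s = rank_term n x s *
     (s ^ (2 * n + 1) * (1 + s ^ (2 * n + 1)) / ((1 - x * s ^ (2 * Suc n)) * (1 - s ^ (2 * Suc n) / x)))"
  by (simp add: rank_term_def qfac_Suc power2_eq_square power_add power_mult_distrib mult_2_right mult_2 mult_ac)

lemma rank_N_eq:
  assumes "(x, s) \<in> rank_dom"
  shows "rank_N x s = (\<Sum>n. rank_term n x s)"
proof -
  have s: "norm (s\<^sup>2) < 1" and ns: "norm (- s) < 1"
    using assms by (auto simp: rank_dom_def norm_power power_less_one_iff)
  have "x * s\<^sup>2 * (s\<^sup>2) ^ k \<noteq> 1" "s\<^sup>2 / x * (s\<^sup>2) ^ k \<noteq> 1" for k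
  proof -
    have "s\<^sup>2 * (s\<^sup>2) ^ k = s ^ (2 * Suc k)"
      by (simp only: power_mult power_Suc)
    thus "x * s\<^sup>2 * (s\<^sup>2) ^ k \<noteq> 1" "s\<^sup>2 / x * (s\<^sup>2) ^ k \<noteq> 1"
      using assms by (auto simp only: rank_dom_def mult.assoc times_divide_eq_left mem_Collect_eq prod.case)
  qed
  thus ?thesis
    unfolding rank_N_def rank_term_def
    using qpoch_pair[OF s] qpoch_single[OF s power_mult_ne_1[OF s ns]] by simp
qed

text \<open>Beyond a large index the ratio of consecutive terms is small, uniformly near the given point;
  the finitely many remaining conditions and terms are controlled by continuity.\<close>

lemma rank_term_local_bound:
  assumes dom: "(x0, s0) \<in> rank_dom"
  obtains e C where "e > 0"
    "\<And>x s. \<lbrakk>x \<in> cball x0 e; s \<in> cball s0 e\<rbrakk> \<Longrightarrow> (x, s) \<in> rank_dom"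
    "\<And>x s n. \<lbrakk>x \<in> cball x0 e; s \<in> cball s0 e\<rbrakk> \<Longrightarrow> norm (rank_term n x s) \<le> C * (1/2) ^ n"
proof -
  define r where "r = (1 + norm s0) / 2"
  have r: "norm s0 < r" "0 < r" "r < 1"
    using dom by (auto simp: rank_dom_def r_def) (smt (verit) norm_ge_zero)
  define R where "R = norm x0 + 1 / norm x0 + 1"
  have x0: "x0 \<noteq> 0" using dom by (auto simp: rank_dom_def)
  have R: "norm x0 < R" "1 / norm x0 < R" "1 < R"
    using x0 by (auto simp: R_def add_pos_nonneg)
  \<comment> \<open>Both \<open>R * r ^ k\<close> and \<open>16 * r ^ k\<close> have to drop below
    1/2. The first keeps the two denominator factors of the term ratio at norm at least 1/2; the
    second bounds its numerator by 2/16. The ratio is then at most (2/16)/(1/4) = 1/2.\<close>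
  have "(\<lambda>n. (R + 16) * r ^ n) \<longlonglongrightarrow> 0"
    using r by (intro tendsto_eq_intros LIMSEQ_realpow_zero) auto
  hence "eventually (\<lambda>n. (R + 16) * r ^ n < 1/2) sequentially"
    by (rule order_tendstoD) auto
  then obtain n0 where n0: "\<And>n. n \<ge> n0 \<Longrightarrow> (R + 16) * r ^ n < 1/2"
    by (auto simp: eventually_sequentially)
  define V where "V = {z :: complex \<times> complex. norm (fst z) < R \<and> 1 < R * norm (fst z) \<and> norm (snd z) < r}"
  define W where "W = {z :: complex \<times> complex. fst z \<noteq> 0 \<and> (\<forall>k<n0. fst z * snd z ^ (2 * Suc k) \<noteq> 1
       \<and> snd z ^ (2 * Suc k) \<noteq> fst z)}"
  have small: "norm (x * s ^ (2 * Suc k)) < 1/2" "norm (s ^ (2 * Suc k) / x) < 1/2"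
      "norm (s ^ (2 * k + 1)) < 1/16" if "(x, s) \<in> V" "k \<ge> n0" for x s k
  proof -
    have V: "norm x < R" "1 < R * norm x" "norm s < r" using that by (auto simp: V_def)
    hence "norm x > 0" by (cases "x = 0") auto
    hence Vi: "norm (inverse x) < R" using V by (simp add: norm_inverse norm_divide inverse_eq_divide divide_less_eq)
    have rk: "(R + 16) * r ^ k < 1/2" using n0 that by auto
    have "norm s ^ (2 * Suc k) \<le> r ^ (2 * Suc k)" using V by (intro power_mono) auto
    also have "\<dots> \<le> r ^ k" using r by (intro power_decreasing) auto
    finally have 1: "norm s ^ (2 * Suc k) \<le> r ^ k" .
    have "norm x * norm s ^ (2 * Suc k) \<le> R * r ^ k" "norm (inverse x) * norm s ^ (2 * Suc k) \<le> R * r ^ k"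
      using V Vi 1 R by (intro mult_mono; simp)+
    moreover have "0 \<le> r ^ k" "0 \<le> R * r ^ k" using r R by auto
    hence "R * r ^ k < 1/2" "16 * r ^ k < 1/2" using rk unfolding distrib_right by linarith+
    ultimately show "norm (x * s ^ (2 * Suc k)) < 1/2" "norm (s ^ (2 * Suc k) / x) < 1/2"
      by (simp_all only: norm_mult norm_power norm_divide norm_inverse divide_inverse mult.commute)
    have "norm s ^ (2 * k + 1) \<le> r ^ (2 * k + 1)" using V by (intro power_mono) auto
    also have "\<dots> \<le> r ^ k" using r by (intro power_decreasing) auto
    also have "r ^ k < 1/16" using \<open>16 * r ^ k < 1/2\<close> by linarith
    finally show "norm (s ^ (2 * k + 1)) < 1/16" by (simp add: norm_power norm_mult)
  qed
  have VW: "(x, s) \<in> rank_dom" if z: "(x, s) \<in> V \<inter> W" for x s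
  proof -
    have "x * s ^ (2 * Suc k) \<noteq> 1 \<and> s ^ (2 * Suc k) / x \<noteq> 1" for k
    proof (cases "k < n0")
      case True
      thus ?thesis using z by (auto simp: W_def)
    next
      case False
      thus ?thesis using small(1,2)[of x s k] z by (auto simp del: mult_Suc_right power_Suc)
    qed
    thus ?thesis using z r by (auto simp: rank_dom_def V_def W_def)
  qed
  have "open (V \<inter> W)"
  proof -
    have "W = {z. fst z \<noteq> 0} \<inter> (\<Inter>k\<in>{..<n0}. {z. fst z * snd z ^ (2 * Suc k) \<noteq> 1} \<inter> {z. snd z ^ (2 * Suc k) \<noteq> fst z})"
      by (auto simp: W_def)
    moreover have "open \<dots>"
      by (intro open_Int open_INT ballI open_Collect_neq continuous_intros) auto
    moreover have "V = {z. norm (fst z) < R} \<inter> {z. 1 < R * norm (fst z)} \<inter> {z. norm (snd z) < r}"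
      by (auto simp: V_def)
    moreover have "open \<dots>"
      by (intro open_Int open_Collect_less continuous_intros)
    ultimately show ?thesis by (metis open_Int)
  qed
  moreover have "(x0, s0) \<in> V \<inter> W"
    using dom r R x0 by (auto simp: V_def W_def rank_dom_def divide_less_eq simp del: power_Suc mult_Suc_right)
  ultimately obtain d where d: "d > 0" "cball (x0, s0) d \<subseteq> V \<inter> W"
    using open_contains_cball by blast
  \<comment> \<open>Half the radius suffices for both coordinates, since the product distance is at
    most the sum of the two distances.\<close>
  define e where "e = d / 2"
  have sub: "cball x0 e \<times> cball s0 e \<subseteq> V \<inter> W"
  proof (clarify)
    fix x s assume "x \<in> cball x0 e" "s \<in> cball s0 e"
    hence "dist (x0, s0) (x, s) \<le> d"
      using sqrt_sum_squares_le_sum[of "dist x0 x" "dist s0 s"] by (simp add: dist_Pair_Pair e_def)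
    thus "(x, s) \<in> V \<inter> W" using d by auto
  qed
  have cont: "continuous_on (cball x0 e \<times> cball s0 e) (\<lambda>z. rank_term n (fst z) (snd z))" for n
  proof (induction n)
    case (Suc n)
    have nz: "1 - fst z * snd z ^ (2 * Suc n) \<noteq> 0 \<and> 1 - snd z ^ (2 * Suc n) / fst z \<noteq> 0 \<and> fst z \<noteq> 0"
      if "z \<in> cball x0 e \<times> cball s0 e" for z
    proof -
      have "(fst z, snd z) \<in> rank_dom" using VW[of "fst z" "snd z"] sub that by (metis prod.collapse subsetD)
      thus ?thesis using rank_domD(2-4) by blast
    qed
    thus ?case unfolding rank_term_Suc
      by (intro continuous_intros Suc ballI) (use nz in \<open>simp_all del: power_Suc mult_Suc_right split_paired_All\<close>)
  qed simp
  define S where "S = cball x0 e \<times> cball s0 e"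
  have "\<exists>B. \<forall>z\<in>S. norm (rank_term n (fst z) (snd z)) \<le> B" for n
  proof -
    have "compact ((\<lambda>z. rank_term n (fst z) (snd z)) ` S)"
      unfolding S_def by (intro compact_continuous_image cont compact_Times compact_cball)
    hence "bounded ((\<lambda>z. rank_term n (fst z) (snd z)) ` S)" by (rule compact_imp_bounded)
    thus ?thesis by (auto simp: bounded_iff)
  qed
  then obtain B where B: "\<And>n z. z \<in> S \<Longrightarrow> norm (rank_term n (fst z) (snd z)) \<le> B n" by metis
  have B0: "B n \<ge> 0" for n
    using B[of "(x0, s0)" n] d by (auto simp: S_def e_def intro: order_trans[OF norm_ge_zero])
  \<comment> \<open>Each early term is dominated through its own summand, the weight 2^n
    compensating the decay (1/2)^n; beyond \<open>n0\<close> the ratio bound takes over.\<close>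
  define C where "C = (\<Sum>n\<le>n0. B n * 2 ^ n)"
  have bd: "norm (rank_term n x s) \<le> C * (1/2) ^ n" if xs: "(x, s) \<in> S" for n x s
  proof (induction n)
    case 0
    have "B 0 * 2 ^ 0 \<le> C" unfolding C_def using B0 by (intro member_le_sum) auto
    thus ?case using B[OF xs, of 0] by simp
  next
    case (Suc n)
    show ?case
    proof (cases "Suc n \<le> n0")
      case True
      hence "B (Suc n) * 2 ^ Suc n \<le> C" unfolding C_def using B0 by (intro member_le_sum) auto
      hence "B (Suc n) \<le> C * (1/2) ^ Suc n" by (simp add: field_simps)
      thus ?thesis using B[OF xs, of "Suc n"] by simp
    next
      case False
      hence n: "n \<ge> n0" by simp
      have xs': "(x, s) \<in> V" using xs sub unfolding S_def by blast
      note sm = small[OF xs' n]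
      have d1: "norm (1 - x * s ^ (2 * Suc n)) \<ge> 1/2"
        using sm(1) norm_triangle_ineq2[of 1 "x * s ^ (2 * Suc n)"] by (simp del: mult_Suc_right power_Suc)
      have d2: "norm (1 - s ^ (2 * Suc n) / x) \<ge> 1/2"
        using sm(2) norm_triangle_ineq2[of 1 "s ^ (2 * Suc n) / x"] by (simp del: mult_Suc_right power_Suc)
      have d3: "norm (1 + s ^ (2 * n + 1)) \<le> 2"
        using sm(3) norm_triangle_ineq[of 1 "s ^ (2 * n + 1)"] by (simp del: power_Suc)
      have "norm (s ^ (2 * n + 1)) * norm (1 + s ^ (2 * n + 1)) \<le> 1/16 * 2"
        using sm(3) d3 by (intro mult_mono) auto
      moreover have "norm (1 - x * s ^ (2 * Suc n)) * norm (1 - s ^ (2 * Suc n) / x) \<ge> 1/2 * (1/2)"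
        using d1 d2 by (intro mult_mono) auto
      ultimately have "norm (s ^ (2 * n + 1) * (1 + s ^ (2 * n + 1)) / ((1 - x * s ^ (2 * Suc n)) * (1 - s ^ (2 * Suc n) / x))) \<le> (1/16*2) / (1/2*(1/2))"
        unfolding norm_mult norm_divide by (intro frac_le) auto
      hence "norm (rank_term (Suc n) x s) \<le> (C * (1/2) ^ n) * (1/2)"
        unfolding rank_term_Suc norm_mult[of "rank_term n x s"]
        using Suc by (intro mult_mono) (auto intro: order_trans[OF norm_ge_zero])
      thus ?thesis by simp
    qed
  qed
  show thesis
  proof (rule that[of e C])
    show "e > 0" using d by (simp add: e_def)
    show "(x, s) \<in> rank_dom" if "x \<in> cball x0 e" "s \<in> cball s0 e" for x s
      using VW[of x s] sub that by blast
    show "norm (rank_term n x s) \<le> C * (1/2) ^ n" if "x \<in> cball x0 e" "s \<in> cball s0 e" for x s n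
      using bd[of x s n] that by (auto simp: S_def)
  qed
qed

section \<open>Separately holomorphic functions\<close>

text \<open>By Osgood's lemma this amounts to joint holomorphy near the point.\<close>

definition sep_holomorphic_at :: "(complex \<Rightarrow> complex \<Rightarrow> complex) \<Rightarrow> complex \<Rightarrow> complex \<Rightarrow> bool" where
  "sep_holomorphic_at f x0 s0 \<longleftrightarrow> (\<exists>e>0. \<exists>B.
     (\<forall>x\<in>ball x0 e. \<forall>s\<in>ball s0 e. norm (f x s) \<le> B) \<and>
     (\<forall>s\<in>ball s0 e. (\<lambda>x. f x s) holomorphic_on ball x0 e) \<and>
     (\<forall>x\<in>ball x0 e. f x holomorphic_on ball s0 e))"

text \<open>The point is that C does not depend on x. Cauchy's inequality turns the common bound B
  into a bound for the second s-derivative; halving the radius leaves room for circles of radius e/4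
  around every point used.\<close>

lemma sep_holomorphic_at_taylor:
  assumes "sep_holomorphic_at f x0 s0"
  obtains e C where "e > 0" "C \<ge> 0"
    "\<And>s. s \<in> ball s0 e \<Longrightarrow> (\<lambda>x. f x s) holomorphic_on ball x0 e"
    "\<And>x. x \<in> ball x0 e \<Longrightarrow> f x holomorphic_on ball s0 e"
    "\<And>x s. x \<in> ball x0 e \<Longrightarrow> s \<in> ball s0 e \<Longrightarrow>
       norm (f x s - f x s0 - (s - s0) * deriv (f x) s0) \<le> C * norm (s - s0) ^ 2"
proof -
  obtain e B where e: "e > 0"
    and B: "\<And>x s. x \<in> ball x0 e \<Longrightarrow> s \<in> ball s0 e \<Longrightarrow> norm (f x s) \<le> B"
    and h1: "\<And>s. s \<in> ball s0 e \<Longrightarrow> (\<lambda>x. f x s) holomorphic_on ball x0 e"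
    and h2: "\<And>x. x \<in> ball x0 e \<Longrightarrow> f x holomorphic_on ball s0 e"
    using assms unfolding sep_holomorphic_at_def by blast
  define C where "C = 2 * B / (e/4)^2"
  have B0: "B \<ge> 0" using B[of x0 s0] e by (auto intro: order_trans[OF norm_ge_zero])
  show thesis
  proof (rule that[of "e/2" C])
    fix x s assume x: "x \<in> ball x0 (e/2)" and s: "s \<in> ball s0 (e/2)"
    hence x': "x \<in> ball x0 e" using e by auto
    have "norm ((deriv ^^ 0) (f x) s - (\<Sum>i\<le>1. (deriv ^^ i) (f x) s0 * (s - s0) ^ i / fact i))
        \<le> C * norm (s - s0) ^ Suc 1 / fact 1"
    proof (rule complex_Taylor[where S = "ball s0 (e/2)"])
      fix i z assume z: "z \<in> ball s0 (e/2)"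
      hence "(deriv ^^ i) (f x) holomorphic_on ball s0 e" "z \<in> ball s0 e"
        using h2[OF x'] e by (auto intro!: holomorphic_higher_deriv)
      hence "((deriv ^^ i) (f x) has_field_derivative (deriv ^^ Suc i) (f x) z) (at z)"
        using holomorphic_derivI[of "(deriv ^^ i) (f x)" "ball s0 e" z] by simp
      thus "((deriv ^^ i) (f x) has_field_derivative (deriv ^^ Suc i) (f x) z) (at z within ball s0 (e/2))"
        by (rule has_field_derivative_at_within)
    next
      fix z assume z: "z \<in> ball s0 (e/2)"
      have sub: "cball z (e/4) \<subseteq> ball s0 e"
        using z e by (auto simp: subset_iff dist_commute)
          (smt (verit) dist_commute dist_triangle)
      have "norm ((deriv ^^ 2) (f x) z) \<le> fact 2 * B / (e/4)^2"
      proof (rule Cauchy_inequality)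
        show "f x holomorphic_on ball z (e/4)"
          using h2[OF x'] by (rule holomorphic_on_subset) (use sub in auto)
        show "continuous_on (cball z (e/4)) (f x)"
          using holomorphic_on_imp_continuous_on[OF h2[OF x']] sub by (rule continuous_on_subset)
        show "norm (f x w) \<le> B" if "norm (z - w) = e/4" for w
          using that sub by (intro B x') (auto simp: dist_norm)
      qed (use e in auto)
      thus "norm ((deriv ^^ Suc 1) (f x) z) \<le> C"
        by (simp add: C_def numeral_2_eq_2)
    qed (use s e in auto)
    thus "norm (f x s - f x s0 - (s - s0) * deriv (f x) s0) \<le> C * norm (s - s0) ^ 2"
      by (simp add: algebra_simps numeral_2_eq_2)
  qed (use e B0 in \<open>auto simp: C_def intro!: holomorphic_on_subset[OF h1] holomorphic_on_subset[OF h2]\<close>)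
qed

text \<open>The difference quotients in s are holomorphic in x, and the uniform Taylor remainder
  makes them converge uniformly in x with error at most C times the step length, so the limit is
  holomorphic as well.\<close>

lemma sep_holomorphic_at_deriv_holomorphic:
  assumes "sep_holomorphic_at f x0 s0"
  obtains e where "e > 0" "(\<lambda>x. deriv (f x) s0) holomorphic_on ball x0 e"
proof -
  obtain e C where e: "e > 0" and C: "C \<ge> 0"
    and h1: "\<And>s. s \<in> ball s0 e \<Longrightarrow> (\<lambda>x. f x s) holomorphic_on ball x0 e"
    and T: "\<And>x s. x \<in> ball x0 e \<Longrightarrow> s \<in> ball s0 e \<Longrightarrow>
       norm (f x s - f x s0 - (s - s0) * deriv (f x) s0) \<le> C * norm (s - s0) ^ 2"
    using sep_holomorphic_at_taylor[OF assms] by metis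
  \<comment> \<open>The summand 2 keeps the step strictly below e already at n = 0.\<close>
  define h where "h = (\<lambda>n. of_real (e / (real n + 2)) :: complex)"
  have h: "h n \<noteq> 0" "norm (h n) < e" "norm (h n) = e / (real n + 2)" for n
    using e unfolding h_def norm_of_real of_real_eq_0_iff by (auto simp: field_simps intro: add_pos_nonneg)
  have "(\<lambda>x. deriv (f x) s0) holomorphic_on ball x0 e"
  proof (rule holomorphic_uniform_sequence)
    show "(\<lambda>x. (f x (s0 + h n) - f x s0) / h n) holomorphic_on ball x0 e" for n
      using h e by (intro holomorphic_intros h1) (auto simp: dist_norm)
    fix x assume "x \<in> ball x0 e"
    then obtain d where d: "d > 0" "cball x d \<subseteq> ball x0 e"
      using open_contains_cball open_ball by blast
    have "uniform_limit (cball x d) (\<lambda>n x. (f x (s0 + h n) - f x s0) / h n) (\<lambda>x. deriv (f x) s0) sequentially"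
    proof (rule metric_uniform_limit_imp_uniform_limit)
      have "(\<lambda>n. C * (e / (real n + 2))) \<longlonglongrightarrow> 0"
        by real_asymp
      thus "uniform_limit (cball x d) (\<lambda>n _. C * (e / (real n + 2))) (\<lambda>_. 0) sequentially"
        by (auto simp: uniform_limit_iff tendsto_iff elim: eventually_mono)
      show "\<forall>\<^sub>F n in sequentially. \<forall>y\<in>cball x d. dist ((f y (s0 + h n) - f y s0) / h n) (deriv (f y) s0)
             \<le> dist (C * (e / (real n + 2))) 0"
      proof (intro always_eventually allI ballI)
        fix n y assume "y \<in> cball x d"
        hence "norm (f y (s0 + h n) - f y s0 - h n * deriv (f y) s0) \<le> C * norm (h n) ^ 2"
          using T[of y "s0 + h n"] d h[of n] by (auto simp: dist_norm)
        hence "norm (f y (s0 + h n) - f y s0 - h n * deriv (f y) s0) / norm (h n) \<le> C * norm (h n)"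
          using h(1)[of n] by (simp add: pos_divide_le_eq power2_eq_square mult.assoc)
        also have "norm (f y (s0 + h n) - f y s0 - h n * deriv (f y) s0) / norm (h n)
            = norm ((f y (s0 + h n) - f y s0) / h n - deriv (f y) s0)"
          using h(1)[of n] by (simp add: diff_divide_distrib flip: norm_divide)
        finally show "dist ((f y (s0 + h n) - f y s0) / h n) (deriv (f y) s0) \<le> dist (C * (e / (real n + 2))) 0"
          using h[of n] C e by (simp add: dist_norm abs_mult)
      qed
    qed
    thus "\<exists>d>0. cball x d \<subseteq> ball x0 e \<and>
        uniform_limit (cball x d) (\<lambda>n x. (f x (s0 + h n) - f x s0) / h n) (\<lambda>x. deriv (f x) s0) sequentially"
      using d by blast
  qed auto
  thus thesis using that e by blast
qed

text \<open>The increment splits into a change of s with first argument g s and a change of the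
  first argument with s0 fixed. The first part needs the remainder bound uniform in x, because g s
  moves, and the continuity of the s-derivative in x; the second is the ordinary chain rule.\<close>

lemma sep_holomorphic_at_chain:
  assumes f: "sep_holomorphic_at f (g s0) s0" and g: "(g has_field_derivative g') (at s0)"
  shows "((\<lambda>s. f (g s) s) has_field_derivative
           (deriv (\<lambda>x. f x s0) (g s0) * g' + deriv (f (g s0)) s0)) (at s0)"
proof -
  obtain e C where e: "e > 0" and C: "C \<ge> 0"
    and h1: "\<And>s. s \<in> ball s0 e \<Longrightarrow> (\<lambda>x. f x s) holomorphic_on ball (g s0) e"
    and T: "\<And>x s. x \<in> ball (g s0) e \<Longrightarrow> s \<in> ball s0 e \<Longrightarrow>
       norm (f x s - f x s0 - (s - s0) * deriv (f x) s0) \<le> C * norm (s - s0) ^ 2"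
    using sep_holomorphic_at_taylor[OF f] by metis
  obtain e' where e': "e' > 0" "(\<lambda>x. deriv (f x) s0) holomorphic_on ball (g s0) e'"
    using sep_holomorphic_at_deriv_holomorphic[OF f] by metis
  have gc: "isCont g s0" using g by (rule DERIV_isCont)
  hence gl: "(g \<longlongrightarrow> g s0) (at s0)" by (simp add: isCont_def)
  have "isCont (\<lambda>x. deriv (f x) s0) (g s0)"
    using holomorphic_on_imp_continuous_on[OF e'(2)] e'(1)
    by (simp add: continuous_on_eq_continuous_at)
  hence l2: "((\<lambda>s. deriv (f (g s)) s0) \<longlongrightarrow> deriv (f (g s0)) s0) (at s0)"
    using gl by (rule isCont_tendsto_compose)
  have "((\<lambda>x. f x s0) has_field_derivative deriv (\<lambda>x. f x s0) (g s0)) (at (g s0))"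
    using h1[of s0] e by (intro holomorphic_derivI[of _ "ball (g s0) e"]) auto
  hence "((\<lambda>s. f (g s) s0) has_field_derivative (deriv (\<lambda>x. f x s0) (g s0) * g')) (at s0)"
    using g by (rule DERIV_chain2)
  hence l3: "((\<lambda>s. (f (g s) s0 - f (g s0) s0) / (s - s0)) \<longlongrightarrow> deriv (\<lambda>x. f x s0) (g s0) * g') (at s0)"
    by (simp add: has_field_derivative_iff)
  have l1: "((\<lambda>s. (f (g s) s - f (g s) s0 - (s - s0) * deriv (f (g s)) s0) / (s - s0)) \<longlongrightarrow> 0) (at s0)"
  proof (rule Lim_null_comparison)
    have "eventually (\<lambda>s. g s \<in> ball (g s0) e) (at s0)"
      by (rule topological_tendstoD[OF gl]) (use e in auto)
    moreover have "eventually (\<lambda>s. s \<in> ball s0 e) (at s0)"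
      by (rule eventually_at_in_open') (use e in auto)
    moreover have "eventually (\<lambda>s. s \<noteq> s0) (at s0)"
      by (simp add: eventually_at_filter)
    ultimately show "eventually (\<lambda>s. norm ((f (g s) s - f (g s) s0 - (s - s0) * deriv (f (g s)) s0) / (s - s0))
        \<le> C * norm (s - s0)) (at s0)"
    proof eventually_elim
      case (elim s)
      thus ?case using T[of "g s" s]
        by (simp add: norm_divide divide_le_eq power2_eq_square mult.assoc)
    qed
    show "((\<lambda>s. C * norm (s - s0)) \<longlongrightarrow> 0) (at s0)"
      by (auto intro!: tendsto_eq_intros)
  qed
  have "((\<lambda>s. (f (g s) s - f (g s0) s0) / (s - s0)) \<longlongrightarrow>
      0 + deriv (f (g s0)) s0 + deriv (\<lambda>x. f x s0) (g s0) * g') (at s0)"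
  proof (rule Lim_transform_eventually[OF tendsto_add[OF tendsto_add[OF l1 l2] l3]])
    show "eventually (\<lambda>s. (f (g s) s - f (g s) s0 - (s - s0) * deriv (f (g s)) s0) / (s - s0) +
        deriv (f (g s)) s0 + (f (g s) s0 - f (g s0) s0) / (s - s0) = (f (g s) s - f (g s0) s0) / (s - s0)) (at s0)"
      unfolding eventually_at_filter
      by (rule always_eventually) (auto simp: diff_divide_distrib)
  qed
  thus ?thesis
    by (simp add: has_field_derivative_iff add.commute)
qed

lemma sep_holomorphic_at_mult_x:
  assumes "sep_holomorphic_at f x0 s0" "g holomorphic_on U" "open U" "x0 \<in> U"
  shows "sep_holomorphic_at (\<lambda>x s. f x s * g x) x0 s0"
proof -
  obtain e B where e: "e > 0"
    and B: "\<And>x s. x \<in> ball x0 e \<Longrightarrow> s \<in> ball s0 e \<Longrightarrow> norm (f x s) \<le> B"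
    and h1: "\<And>s. s \<in> ball s0 e \<Longrightarrow> (\<lambda>x. f x s) holomorphic_on ball x0 e"
    and h2: "\<And>x. x \<in> ball x0 e \<Longrightarrow> f x holomorphic_on ball s0 e"
    using assms unfolding sep_holomorphic_at_def by blast
  obtain d where d: "d > 0" "cball x0 d \<subseteq> U" using assms open_contains_cball by blast
  have "compact (g ` cball x0 d)"
    using holomorphic_on_imp_continuous_on[OF assms(2)] d
    by (intro compact_continuous_image) (auto intro: continuous_on_subset)
  then obtain M where M: "\<And>x. x \<in> cball x0 d \<Longrightarrow> norm (g x) \<le> M"
    by (meson bounded_iff compact_imp_bounded image_eqI)
  define r where "r = min e d"
  have r: "r > 0" "r \<le> e" "r \<le> d" using e d by (auto simp: r_def)
  have b: "norm (f x s * g x) \<le> B * M" if "x \<in> ball x0 r" "s \<in> ball s0 r" for x s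
    unfolding norm_mult using that r B[of x s] M[of x]
    by (intro mult_mono) (auto intro: order_trans[OF norm_ge_zero])
  have c: "(\<lambda>x. f x s * g x) holomorphic_on ball x0 r" if "s \<in> ball s0 r" for s
    using that r d by (intro holomorphic_intros holomorphic_on_subset[OF h1] holomorphic_on_subset[OF assms(2)]) auto
  have "(\<lambda>s. f x s * g x) holomorphic_on ball s0 r" if "x \<in> ball x0 r" for x
    using that r by (intro holomorphic_intros holomorphic_on_subset[OF h2]) auto
  with b c r show ?thesis unfolding sep_holomorphic_at_def by blast
qed

text \<open>One geometric majorant, valid on a product of two discs, yields both the uniform bound
  and the locally uniform convergence in each variable separately.\<close>

lemma sep_holomorphic_at_rank_N:
  assumes "(x0, s0) \<in> rank_dom"
  shows "sep_holomorphic_at rank_N x0 s0"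
proof -
  obtain e C where e: "e > 0"
    and dom: "\<And>x s. \<lbrakk>x \<in> cball x0 e; s \<in> cball s0 e\<rbrakk> \<Longrightarrow> (x, s) \<in> rank_dom"
    and C: "\<And>x s n. \<lbrakk>x \<in> cball x0 e; s \<in> cball s0 e\<rbrakk> \<Longrightarrow> norm (rank_term n x s) \<le> C * (1/2) ^ n"
    using rank_term_local_bound[OF assms] by metis
  have sumC: "summable (\<lambda>n. C * (1/2) ^ n)" by (intro summable_mult summable_geometric) auto
  have dd: "x \<noteq> 0 \<and> (1 - x * s ^ (2 * Suc n)) \<noteq> 0 \<and> (1 - s ^ (2 * Suc n) / x) \<noteq> 0"
    if "x \<in> ball x0 e" "s \<in> ball s0 e" for x s n
    using rank_domD(2-4)[OF dom[of x s]] that by auto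
  have t1: "(\<lambda>x. rank_term n x s) holomorphic_on ball x0 e" if "s \<in> ball s0 e" for n s
  proof (induction n)
    case (Suc n)
    show ?case unfolding rank_term_Suc using dd[OF _ that]
      by (intro holomorphic_intros Suc) auto
  qed simp
  have t2: "rank_term n x holomorphic_on ball s0 e" if "x \<in> ball x0 e" for n x
  proof (induction n)
    case (Suc n)
    show ?case unfolding rank_term_Suc[abs_def] using dd[OF that]
      by (intro holomorphic_intros Suc) auto
  qed (simp add: rank_term_0[abs_def] flip: rank_term_0)
  have "norm (rank_N x s) \<le> (\<Sum>n. C * (1/2) ^ n)" if "x \<in> ball x0 e" "s \<in> ball s0 e" for x s
  proof -
    have xs: "x \<in> cball x0 e" "s \<in> cball s0 e" using that by auto
    show ?thesis unfolding rank_N_eq[OF dom[OF xs]] by (intro norm_suminf_le sumC C xs)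
  qed
  moreover have "(\<lambda>x. rank_N x s) holomorphic_on ball x0 e" if s: "s \<in> ball s0 e" for s
  proof (rule holomorphic_uniform_sequence)
    show "(\<lambda>x. \<Sum>n<m. rank_term n x s) holomorphic_on ball x0 e" for m
      by (intro holomorphic_intros t1 s)
    fix x assume "x \<in> ball x0 e"
    then obtain d where d: "d > 0" "cball x d \<subseteq> ball x0 e"
      using open_contains_cball open_ball by blast
    have "uniform_limit (cball x d) (\<lambda>m x. \<Sum>n<m. rank_term n x s) (\<lambda>x. \<Sum>n. rank_term n x s) sequentially"
      by (rule Weierstrass_m_test[OF _ sumC], rule C) (use d s in auto)
    also have "?this \<longleftrightarrow> uniform_limit (cball x d) (\<lambda>m x. \<Sum>n<m. rank_term n x s) (\<lambda>x. rank_N x s) sequentially"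
      by (rule uniform_limit_cong') (use d s in \<open>auto simp: subset_iff intro!: rank_N_eq[symmetric] dom\<close>)
    finally show "\<exists>d>0. cball x d \<subseteq> ball x0 e \<and>
        uniform_limit (cball x d) (\<lambda>m x. \<Sum>n<m. rank_term n x s) (\<lambda>x. rank_N x s) sequentially"
      using d by blast
  qed auto
  moreover have "rank_N x holomorphic_on ball s0 e" if x: "x \<in> ball x0 e" for x
  proof (rule holomorphic_uniform_sequence)
    show "(\<lambda>s. \<Sum>n<m. rank_term n x s) holomorphic_on ball s0 e" for m
      by (intro holomorphic_intros t2 x)
    fix s assume "s \<in> ball s0 e"
    then obtain d where d: "d > 0" "cball s d \<subseteq> ball s0 e"
      using open_contains_cball open_ball by blast
    have "uniform_limit (cball s d) (\<lambda>m s. \<Sum>n<m. rank_term n x s) (\<lambda>s. \<Sum>n. rank_term n x s) sequentially"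
      by (rule Weierstrass_m_test[OF _ sumC], rule C) (use d x in auto)
    also have "?this \<longleftrightarrow> uniform_limit (cball s d) (\<lambda>m s. \<Sum>n<m. rank_term n x s) (rank_N x) sequentially"
      by (rule uniform_limit_cong') (use d x in \<open>auto simp: subset_iff intro!: rank_N_eq[symmetric] dom\<close>)
    finally show "\<exists>d>0. cball s d \<subseteq> ball s0 e \<and>
        uniform_limit (cball s d) (\<lambda>m s. \<Sum>n<m. rank_term n x s) (rank_N x) sequentially"
      using d by blast
  qed auto
  ultimately show ?thesis using e unfolding sep_holomorphic_at_def by blast
qed

section \<open>The functional equation of the rank function\<close>

lemma rank_term_summable:
  assumes "(x, s) \<in> rank_dom"
  shows "summable (\<lambda>n. rank_term n x s)" "(\<lambda>n. rank_term n x s) \<longlonglongrightarrow> 0"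
proof -
  obtain e C where e: "e > 0"
    and C: "\<And>x' s' n. \<lbrakk>x' \<in> cball x e; s' \<in> cball s e\<rbrakk> \<Longrightarrow> norm (rank_term n x' s') \<le> C * (1/2) ^ n"
    using rank_term_local_bound[OF assms] by metis
  have "summable (\<lambda>n. C * (1/2) ^ n)" by (intro summable_mult summable_geometric) auto
  thus "summable (\<lambda>n. rank_term n x s)"
    by (rule summable_comparison_test'[where N = 0]) (use C[of x s] e in auto)
  thus "(\<lambda>n. rank_term n x s) \<longlonglongrightarrow> 0" by (rule summable_LIMSEQ_zero)
qed

section \<open>The shift-invariant domain of N* and its functional equation\<close>

definition star_dom :: "(complex \<times> complex) set" where
  "star_dom = {(x, s). (x, s) \<in> rank_dom \<and> x \<noteq> 1}"

text \<open>Starting k at 0 absorbs the condition that x is not 1. For nonzero s the excluded points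
  are then 0 and all s^(2m) with m an integer, a set visibly stable under x -> x s^2.\<close>

lemma star_dom_iff:
  "(x, s) \<in> star_dom \<longleftrightarrow> norm s < 1 \<and> x \<noteq> 0 \<and> (\<forall>k. x * s ^ (2 * k) \<noteq> 1 \<and> s ^ (2 * k) \<noteq> x)"
proof -
  have "(\<forall>k. x * s ^ (2 * k) \<noteq> 1 \<and> s ^ (2 * k) \<noteq> x) \<longleftrightarrow>
      x \<noteq> 1 \<and> (\<forall>k. x * s ^ (2 * Suc k) \<noteq> 1 \<and> s ^ (2 * Suc k) \<noteq> x)"
    by (metis mult_0_right mult_1_right not0_implies_Suc power_0)
  thus ?thesis by (auto simp: star_dom_def rank_dom_def)
qed


lemma star_dom_shift:
  assumes "s \<noteq> 0"
  shows "(x * s\<^sup>2, s) \<in> star_dom \<longleftrightarrow> (x, s) \<in> star_dom"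
proof -
  have "(\<forall>k. x * s\<^sup>2 * s ^ (2 * k) \<noteq> 1 \<and> s ^ (2 * k) \<noteq> x * s\<^sup>2) \<longleftrightarrow>
      (\<forall>k. x * s ^ (2 * k) \<noteq> 1 \<and> s ^ (2 * k) \<noteq> x)" (is "?L \<longleftrightarrow> ?R")
  proof
    assume L: ?L
    show ?R
    proof
      fix k
      have "s ^ (2 * Suc k) \<noteq> x * s\<^sup>2" using L by blast
      hence 1: "s ^ (2 * k) \<noteq> x" by (auto simp: power2_eq_square)
      have "x * s ^ (2 * k) \<noteq> 1"
      proof (cases k)
        case 0
        have "s ^ (2 * 1) \<noteq> x * s\<^sup>2" using L by blast
        thus ?thesis using 0 by (auto simp: power2_eq_square)
      next
        case (Suc j)
        thus ?thesis using L[rule_format, of j] by (simp add: power2_eq_square mult_ac)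
      qed
      with 1 show "x * s ^ (2 * k) \<noteq> 1 \<and> s ^ (2 * k) \<noteq> x" by blast
    qed
  next
    assume R: ?R
    show ?L
    proof
      fix k
      have "x * s ^ (2 * Suc k) \<noteq> 1" using R by blast
      hence 1: "x * s\<^sup>2 * s ^ (2 * k) \<noteq> 1" by (simp add: power2_eq_square mult_ac)
      have "s ^ (2 * k) \<noteq> x * s\<^sup>2"
      proof (cases k)
        case 0
        have "x * s ^ (2 * 1) \<noteq> 1" using R by blast
        thus ?thesis using 0 by (auto simp: power2_eq_square)
      next
        case (Suc j)
        thus ?thesis using R[rule_format, of j] assms by (auto simp: power2_eq_square mult_ac)
      qed
      with 1 show "x * s\<^sup>2 * s ^ (2 * k) \<noteq> 1 \<and> s ^ (2 * k) \<noteq> x * s\<^sup>2" by blast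
    qed
  qed
  thus ?thesis using assms by (simp add: star_dom_iff)
qed

lemma rank_N_star_shift:
  assumes d: "(x, s) \<in> star_dom" and s: "s \<noteq> 0"
  shows "rank_N_star (x * s\<^sup>2) s = - s * x\<^sup>2 * rank_N_star x s - s * x + 1"
proof -
  have x: "x \<noteq> 0" "x \<noteq> 1" and dx: "(x, s) \<in> rank_dom"
    using d rank_domD(2)[of x s] by (auto simp: star_dom_def)
  have d': "(x * s\<^sup>2, s) \<in> star_dom" using d s by (simp add: star_dom_shift)
  hence dy: "(x * s\<^sup>2, s) \<in> rank_dom" and xs: "x * s\<^sup>2 \<noteq> 1" by (auto simp: star_dom_def)
  \<comment> \<open>A telescoping certificate. With Q = s^(2n), shifting x multiplies the n-th
    summand of N* by -(x - Q)/(1 - x s^2 Q). The factor x - Q in U cancels the new denominator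
    factor 1 - s^2 Q/x on passing to n + 1, and 1 - s x makes the remaining rational identity hold.
    Its start value -U 0 = 1 - s x is the inhomogeneous part.\<close>
  define U where "U = (\<lambda>n. rank_term n x s / (1 - x) * ((x - s ^ (2 * n)) * (1 - s * x)))"
  have tele: "rank_term n (x * s\<^sup>2) s / (1 - x * s\<^sup>2) + s * x\<^sup>2 * (rank_term n x s / (1 - x)) = U (Suc n) - U n" for n
  proof -
    define Q where "Q = s ^ (2 * n)"
    define a b where "a = qfac (x * s\<^sup>2) (s\<^sup>2) n" and "b = qfac (s\<^sup>2 / x) (s\<^sup>2) n"
    have pQ: "(s\<^sup>2) ^ n = Q" by (simp add: Q_def power_mult)
    have nz1: "1 - x * s\<^sup>2 * Q \<noteq> 0" "1 - s\<^sup>2 * Q / x \<noteq> 0"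
      using rank_domD(3,4)[OF dx, of n] by (simp_all add: Q_def power2_eq_square mult_ac)
    have nz2: "x - Q \<noteq> 0" using d by (auto simp: star_dom_iff Q_def)
    have nz3: "x - s\<^sup>2 * Q \<noteq> 0" using nz1(2) x by (auto simp: field_simps)
    have A: "(1 - x * s\<^sup>2) * qfac (x * s\<^sup>2 * s\<^sup>2) (s\<^sup>2) n = a * (1 - x * s\<^sup>2 * Q)"
      using qfac_shift[of "x * s\<^sup>2" "s\<^sup>2" n] by (simp add: a_def pQ)
    have "(1 - 1/x) * qfac (1/x * s\<^sup>2) (s\<^sup>2) n = qfac (1/x) (s\<^sup>2) n * (1 - 1/x * Q)"
      using qfac_shift[of "1/x" "s\<^sup>2" n] by (simp add: pQ)
    hence "(x - 1) * b = qfac (1/x) (s\<^sup>2) n * (x - Q)"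
      using x by (simp add: b_def field_simps)
    hence B: "qfac (1/x) (s\<^sup>2) n = (x - 1) * b / (x - Q)"
      using nz2 by (simp add: field_simps)
    have A': "qfac (x * s\<^sup>2 * s\<^sup>2) (s\<^sup>2) n = a * (1 - x * s\<^sup>2 * Q) / (1 - x * s\<^sup>2)"
      using A xs by (simp add: field_simps)
    have ts: "rank_term n (x * s\<^sup>2) s / (1 - x * s\<^sup>2) =
        - rank_term n x s / (1 - x) * ((x - Q) / (1 - x * s\<^sup>2 * Q))"
    proof -
      have "s\<^sup>2 / (x * s\<^sup>2) = 1 / x" using s by simp
      hence r1: "rank_term n (x * s\<^sup>2) s = s ^ n\<^sup>2 * qfac (- s) (s\<^sup>2) n /
          (a * (1 - x * s\<^sup>2 * Q) / (1 - x * s\<^sup>2) * ((x - 1) * b / (x - Q)))"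
        unfolding rank_term_def A' by (simp add: B)
      have r2: "rank_term n x s = s ^ n\<^sup>2 * qfac (- s) (s\<^sup>2) n / (a * b)"
        by (simp add: rank_term_def a_def b_def)
      have gen: "T / (a * M / X * ((x - 1) * b / (x - Q))) / X = - (T / (a * b)) / (1 - x) * ((x - Q) / M)"
        if "X \<noteq> 0" for T M X :: complex
      proof -
        have "T / (a * M / X * ((x - 1) * b / (x - Q))) / X = T * (x - Q) / (a * M * ((x - 1) * b))"
          using that nz2 by simp
        also have "\<dots> = T * (x - Q) / (- (a * b * (1 - x) * M))" by (simp add: algebra_simps)
        also have "\<dots> = - (T / (a * b)) / (1 - x) * ((x - Q) / M)" by simp
        finally show ?thesis .
      qed
      show ?thesis unfolding r1 r2 using xs by (intro gen) auto
    qed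
    have tS: "rank_term (Suc n) x s = rank_term n x s * (s * Q * (1 + s * Q) / ((1 - x * s\<^sup>2 * Q) * (1 - s\<^sup>2 * Q / x)))"
      unfolding rank_term_Suc by (simp add: Q_def power2_eq_square mult_ac)
    have "1 - s\<^sup>2 * Q / x = (x - s\<^sup>2 * Q) / x" using x by (simp add: field_simps)
    hence US: "U (Suc n) = rank_term n x s / (1 - x) * (s * Q * (1 + s * Q) * x * (1 - s * x) / (1 - x * s\<^sup>2 * Q))"
      using nz3 x nz1 unfolding U_def tS by (simp add: Q_def power2_eq_square mult_ac)
    have "- ((x - Q) / (1 - x * s\<^sup>2 * Q)) + s * x\<^sup>2 =
        s * Q * (1 + s * Q) * x * (1 - s * x) / (1 - x * s\<^sup>2 * Q) - (x - Q) * (1 - s * x)"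
      using nz1 by (simp add: divide_simps) algebra
    moreover have "- w * F + s * x\<^sup>2 * w = w * G - w * H" if "- F + s * x\<^sup>2 = G - H" for w F G H :: complex
    proof -
      have "w * (- F + s * x\<^sup>2) = w * (G - H)" using that by simp
      thus ?thesis by (simp add: algebra_simps)
    qed
    ultimately show ?thesis
      unfolding ts US unfolding U_def Q_def[symmetric] minus_divide_left[symmetric] by blast
  qed
  have "U \<longlonglongrightarrow> 0"
  proof -
    have "(\<lambda>n. s ^ (2 * n)) \<longlonglongrightarrow> 0"
      using d unfolding power_mult by (intro LIMSEQ_power_zero) (auto simp: star_dom_iff norm_power power_less_one_iff)
    hence "U \<longlonglongrightarrow> 0 / (1 - x) * ((x - 0) * (1 - s * x))"
      unfolding U_def using x by (intro tendsto_intros rank_term_summable[OF dx]) auto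
    thus ?thesis by simp
  qed
  hence "(\<lambda>n. U (Suc n) - U n) sums (0 - U 0)" by (rule telescope_sums)
  moreover have "U 0 = - (1 - s * x)" using x by (simp add: U_def field_simps)
  ultimately have *: "(\<lambda>n. rank_term n (x * s\<^sup>2) s / (1 - x * s\<^sup>2) + s * x\<^sup>2 * (rank_term n x s / (1 - x))) sums (1 - s * x)"
    unfolding tele by simp
  have "(\<lambda>n. rank_term n (x * s\<^sup>2) s / (1 - x * s\<^sup>2) + s * x\<^sup>2 * (rank_term n x s / (1 - x))) sums
     (rank_N_star (x * s\<^sup>2) s + s * x\<^sup>2 * rank_N_star x s)"
    unfolding rank_N_star_def rank_N_eq[OF dx] rank_N_eq[OF dy]
    by (intro sums_add sums_mult sums_divide summable_sums rank_term_summable dx dy)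
  from sums_unique2[OF this *] show ?thesis by (simp add: algebra_simps)
qed

section \<open>The differential operator\<close>

lemma star_dom_nbhd:
  assumes "(x0, s0) \<in> star_dom"
  obtains e where "e > 0" "\<And>x s. x \<in> ball x0 e \<Longrightarrow> s \<in> ball s0 e \<Longrightarrow> (x, s) \<in> star_dom"
proof -
  have d: "(x0, s0) \<in> rank_dom" "x0 \<noteq> 1" using assms by (auto simp: star_dom_def)
  obtain e C where e: "e > 0"
    and dom: "\<And>x s. \<lbrakk>x \<in> cball x0 e; s \<in> cball s0 e\<rbrakk> \<Longrightarrow> (x, s) \<in> rank_dom"
    using rank_term_local_bound[OF d(1)] by metis
  show thesis
  proof (rule that[of "min e (dist x0 1)"])
    show "min e (dist x0 1) > 0" using e d by auto
    show "(x, s) \<in> star_dom" if "x \<in> ball x0 (min e (dist x0 1))"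
      "s \<in> ball s0 (min e (dist x0 1))" for x s
      using that dom[of x s] by (auto simp: star_dom_def dist_norm)
  qed
qed

lemma open_star_dom: "open {x. (x, s) \<in> star_dom}" "open {s. (x, s) \<in> star_dom}"
proof -
  have "\<exists>e>0. ball x e \<subseteq> {x. (x, s) \<in> star_dom}" if "(x, s) \<in> star_dom" for x
  proof -
    obtain e where "e > 0" "\<And>x' s'. x' \<in> ball x e \<Longrightarrow> s' \<in> ball s e \<Longrightarrow> (x', s') \<in> star_dom"
      using star_dom_nbhd[OF \<open>(x, s) \<in> star_dom\<close>] by metis
    thus ?thesis by (intro exI[of _ e]) auto
  qed
  thus "open {x. (x, s) \<in> star_dom}" by (simp add: open_contains_ball)
  have "\<exists>e>0. ball s e \<subseteq> {s. (x, s) \<in> star_dom}" if "(x, s) \<in> star_dom" for s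
  proof -
    obtain e where "e > 0" "\<And>x' s'. x' \<in> ball x e \<Longrightarrow> s' \<in> ball s e \<Longrightarrow> (x', s') \<in> star_dom"
      using star_dom_nbhd[OF \<open>(x, s) \<in> star_dom\<close>] by metis
    thus ?thesis by (intro exI[of _ e]) auto
  qed
  thus "open {s. (x, s) \<in> star_dom}" by (simp add: open_contains_ball)
qed

lemma sep_holomorphic_at_rank_N_star:
  assumes "(x0, s0) \<in> star_dom"
  shows "sep_holomorphic_at rank_N_star x0 s0"
proof -
  have "sep_holomorphic_at (\<lambda>x s. rank_N x s * (1 / (1 - x))) x0 s0"
    using assms
    by (intro sep_holomorphic_at_mult_x[where U = "- {1}"] sep_holomorphic_at_rank_N holomorphic_intros) (auto simp: star_dom_def)
  thus ?thesis by (simp add: rank_N_star_def[abs_def])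
qed

lemma sep_holomorphic_at_differentiable:
  assumes "sep_holomorphic_at f x0 s0"
  shows "(\<lambda>x. f x s0) field_differentiable at x0" "f x0 field_differentiable at s0"
proof -
  obtain e where e: "e > 0"
    and h1: "\<And>s. s \<in> ball s0 e \<Longrightarrow> (\<lambda>x. f x s) holomorphic_on ball x0 e"
    and h2: "\<And>x. x \<in> ball x0 e \<Longrightarrow> f x holomorphic_on ball s0 e"
    using assms unfolding sep_holomorphic_at_def by blast
  show "(\<lambda>x. f x s0) field_differentiable at x0" "f x0 field_differentiable at s0"
    using h1[of s0] h2[of x0] e
    by (auto intro!: holomorphic_on_imp_differentiable_at[of _ "ball _ e"])
qed

lemma sep_holomorphic_at_holomorphic_x:
  assumes "\<And>x. x \<in> D \<Longrightarrow> sep_holomorphic_at f x s" "open D"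
  shows "(\<lambda>x. f x s) holomorphic_on D"
  using sep_holomorphic_at_differentiable(1)[OF assms(1)] assms(2)
  by (auto simp: holomorphic_on_open field_differentiable_def)

lemma sep_holomorphic_at_deriv_holomorphic_on:
  assumes "\<And>x. x \<in> D \<Longrightarrow> sep_holomorphic_at f x s" "open D"
  shows "(\<lambda>x. deriv (f x) s) holomorphic_on D"
proof -
  have "(\<lambda>x. deriv (f x) s) field_differentiable at x" if x: "x \<in> D" for x
  proof -
    obtain e where "e > 0" "(\<lambda>x. deriv (f x) s) holomorphic_on ball x e"
      using sep_holomorphic_at_deriv_holomorphic[OF assms(1)[OF x]] by metis
    thus ?thesis by (intro holomorphic_on_imp_differentiable_at[of _ "ball x e"]) auto
  qed
  thus ?thesis using assms(2)
    by (auto simp: holomorphic_on_open field_differentiable_def)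
qed

text \<open>The operator x d/dx commutes with the dilation x -> xc, so a functional equation for
  f(xc) can be differentiated on its right-hand side without producing powers of c.\<close>

lemma euler_op_scaled:
  assumes "open D" "f holomorphic_on D" "\<And>x. x \<in> D \<Longrightarrow> x * c \<in> D" "\<And>x. x \<in> D \<Longrightarrow> f (x * c) = r x"
    and "x \<in> D" "(r has_field_derivative r') (at x)"
  shows "euler_op f (x * c) = x * r'"
proof -
  have "(f has_field_derivative deriv f (x * c)) (at (x * c))"
    using assms by (intro holomorphic_derivI) auto
  hence "((\<lambda>x. f (x * c)) has_field_derivative (deriv f (x * c) * c)) (at x)"
    by (rule DERIV_chain2) (auto intro!: derivative_eq_intros)
  moreover have "((\<lambda>x. f (x * c)) has_field_derivative r') (at x)"
    by (rule has_field_derivative_transform_within_open[OF assms(6,1,5)]) (simp add: assms(4))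
  ultimately have "deriv f (x * c) * c = r'" by (rule DERIV_unique)
  thus ?thesis by (auto simp: euler_op_def)
qed

text \<open>With \<open>P = 2\<delta>\<^sub>q + \<delta>\<^sub>x + \<delta>\<^sub>x\<^sup>2\<close>, the substitution \<open>x \<mapsto> xq\<^sup>2\<close> turns \<open>P\<close> into
  \<open>2\<delta>\<^sub>q - 3\<delta>\<^sub>x + \<delta>\<^sub>x\<^sup>2\<close>, conjugation by \<open>qx\<^sup>2\<close> turns it back, and the inhomogeneous part
  \<open>1 - qx\<close> is annihilated.\<close>

lemma rank_pde_shift:
  assumes d: "(x, q) \<in> star_dom" and q: "q \<noteq> 0"
  shows "2 * delta_q rank_N_star (x * q\<^sup>2) q + delta_x rank_N_star (x * q\<^sup>2) q
      + delta_x (delta_x rank_N_star) (x * q\<^sup>2) q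
    = - q * x\<^sup>2 * (2 * delta_q rank_N_star x q + delta_x rank_N_star x q
      + delta_x (delta_x rank_N_star) x q)"
proof -
  define D where "D = {x. (x, q) \<in> star_dom}"
  have D: "open D" "x \<in> D" using open_star_dom(1) d by (auto simp: D_def)
  have Dc: "y * q\<^sup>2 \<in> D" if "y \<in> D" for y using that q by (simp add: D_def star_dom_shift)
  define f where "f = (\<lambda>y. rank_N_star y q)"
  have fh: "f holomorphic_on D" unfolding f_def
    by (rule sep_holomorphic_at_holomorphic_x[OF _ D(1)]) (simp add: sep_holomorphic_at_rank_N_star D_def)
  have fd: "(f has_field_derivative deriv f y) (at y)" if "y \<in> D" for y
    using fh D(1) that by (rule holomorphic_derivI)
  have gh: "euler_op f holomorphic_on D" unfolding euler_op_def
    by (intro holomorphic_intros holomorphic_deriv fh D)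
  have gd: "(euler_op f has_field_derivative deriv (euler_op f) y) (at y)" if "y \<in> D" for y
    using gh D(1) that by (rule holomorphic_derivI)
  have f1: "f (y * q\<^sup>2) = - q * y\<^sup>2 * f y - q * y + 1" if "y \<in> D" for y
    using rank_N_star_shift[of y q] that q by (simp add: f_def D_def)
  have g1: "euler_op f (y * q\<^sup>2) = - 2 * q * y\<^sup>2 * f y - q * y\<^sup>2 * euler_op f y - q * y" if y: "y \<in> D" for y
  proof -
    have "euler_op f (y * q\<^sup>2) = y * (- 2 * q * y * f y - q * y\<^sup>2 * deriv f y - q)"
      by (rule euler_op_scaled[OF D(1) fh Dc f1 y])
         (auto intro!: derivative_eq_intros fd[OF y] simp: power2_eq_square algebra_simps)
    thus ?thesis by (simp add: euler_op_def power2_eq_square algebra_simps)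
  qed
  have h1: "euler_op (euler_op f) (x * q\<^sup>2) = - 4 * q * x\<^sup>2 * f x - 4 * q * x\<^sup>2 * euler_op f x
      - q * x\<^sup>2 * euler_op (euler_op f) x - q * x"
  proof -
    have "euler_op (euler_op f) (x * q\<^sup>2) = x * (- 4 * q * x * f x - 2 * q * x\<^sup>2 * deriv f x
        - 2 * q * x * euler_op f x - q * x\<^sup>2 * deriv (euler_op f) x - q)"
      by (rule euler_op_scaled[OF D(1) gh Dc g1 D(2)])
         (auto intro!: derivative_eq_intros fd[OF D(2)] gd[OF D(2)] simp: power2_eq_square algebra_simps)
    thus ?thesis by (simp add: euler_op_def power2_eq_square algebra_simps)
  qed
  \<comment> \<open>Along s -> (x s^2, s) the first argument moves too, which contributes twice the
    x-derivative at the shifted point. Solving for the pure q-derivative turns the coefficient 1 of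
    \<open>delta_x\<close> into 1 - 4 = -3.\<close>
  have k1: "2 * euler_op f (x * q\<^sup>2) + euler_op (rank_N_star (x * q\<^sup>2)) q =
      - q * x\<^sup>2 * f x - q * x\<^sup>2 * euler_op (rank_N_star x) q - q * x"
  proof -
    have "((\<lambda>s. rank_N_star (x * s\<^sup>2) s) has_field_derivative
        (deriv (\<lambda>y. rank_N_star y q) (x * q\<^sup>2) * (2 * x * q) + deriv (rank_N_star (x * q\<^sup>2)) q)) (at q)"
      using Dc[OF D(2)]
      by (intro sep_holomorphic_at_chain sep_holomorphic_at_rank_N_star) (auto simp: D_def intro!: derivative_eq_intros)
    moreover have "((\<lambda>s. rank_N_star (x * s\<^sup>2) s) has_field_derivative
        (- x\<^sup>2 * f x - q * x\<^sup>2 * deriv (rank_N_star x) q - x)) (at q)"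
    \<comment> \<open>The functional equation is available for nonzero s only, hence the removal of
      0 from the neighbourhood of q.\<close>
    proof (rule has_field_derivative_transform_within_open[OF _ open_Int[OF open_star_dom(2)[of x] open_Compl[OF closed_singleton[of 0]]]])
      have "(rank_N_star x has_field_derivative deriv (rank_N_star x) q) (at q)"
        using sep_holomorphic_at_differentiable(2)[OF sep_holomorphic_at_rank_N_star[OF d]] by (simp add: field_differentiable_derivI)
      thus "((\<lambda>s. - s * x\<^sup>2 * rank_N_star x s - s * x + 1) has_field_derivative
        (- x\<^sup>2 * f x - q * x\<^sup>2 * deriv (rank_N_star x) q - x)) (at q)"
        by (auto intro!: derivative_eq_intros simp: f_def algebra_simps)
    qed (use d q in \<open>auto simp: rank_N_star_shift\<close>)
    ultimately have "deriv (\<lambda>y. rank_N_star y q) (x * q\<^sup>2) * (2 * x * q) + deriv (rank_N_star (x * q\<^sup>2)) q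
       = - x\<^sup>2 * f x - q * x\<^sup>2 * deriv (rank_N_star x) q - x"
      by (rule DERIV_unique)
    hence "q * (deriv f (x * q\<^sup>2) * (2 * x * q) + deriv (rank_N_star (x * q\<^sup>2)) q) =
       q * (- x\<^sup>2 * f x - q * x\<^sup>2 * deriv (rank_N_star x) q - x)"
      by (simp add: f_def)
    thus ?thesis by (simp add: euler_op_def power2_eq_square algebra_simps)
  qed
  have e: "delta_x rank_N_star y q = euler_op f y" "delta_x (delta_x rank_N_star) y q = euler_op (euler_op f) y"
    "delta_q rank_N_star y q = euler_op (rank_N_star y) q" for y
    by (simp_all add: delta_x_def delta_q_def f_def)
  have k2: "euler_op (rank_N_star (x * q\<^sup>2)) q =
      - q * x\<^sup>2 * f x - q * x\<^sup>2 * euler_op (rank_N_star x) q - q * x - 2 * euler_op f (x * q\<^sup>2)"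
    using k1 by (simp add: algebra_simps)
  show ?thesis unfolding e k2 h1 g1[OF D(2)] by (simp add: algebra_simps)
qed

text \<open>Product rule with u = 1/(1 - x): here delta_x u = x/(1 - x)^2 and delta_x^2 u = x(1 +
  x)/(1 - x)^3. Their sum 2x/(1 - x)^3 produces the term 2xN, and u + 2 delta_x u = (1 + x)/(1 -
  x)^2 the coefficient of delta_x N. The right-hand side no longer has a pole at x = 1.\<close>

lemma rank_pde_star:
  assumes d: "(x, q) \<in> star_dom"
  shows "(1 - x) ^ 3 * (2 * delta_q rank_N_star x q + delta_x rank_N_star x q + delta_x (delta_x rank_N_star) x q)
    = 2 * (1 - x)\<^sup>2 * delta_q rank_N x q + (1 + x) * (1 - x) * delta_x rank_N x q
              + 2 * x * rank_N x q + (1 - x)\<^sup>2 * delta_x (delta_x rank_N) x q"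
proof -
  define D where "D = {x. (x, q) \<in> star_dom}"
  have D: "open D" "x \<in> D" using open_star_dom(1) d by (auto simp: D_def)
  have D1: "y \<noteq> 1" if "y \<in> D" for y using that by (auto simp: D_def star_dom_def)
  have hN: "sep_holomorphic_at rank_N y q" if "y \<in> D" for y
    using that by (intro sep_holomorphic_at_rank_N) (auto simp: D_def star_dom_def)
  define f where "f = (\<lambda>y. rank_N y q)"
  have fh: "f holomorphic_on D" unfolding f_def
    by (rule sep_holomorphic_at_holomorphic_x[OF hN D(1)])
  have fd: "(f has_field_derivative deriv f y) (at y)" if "y \<in> D" for y
    using fh D(1) that by (rule holomorphic_derivI)
  have gh: "euler_op f holomorphic_on D" unfolding euler_op_def
    by (intro holomorphic_intros holomorphic_deriv fh D)
  have gd: "(euler_op f has_field_derivative deriv (euler_op f) y) (at y)" if "y \<in> D" for y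
    using gh D(1) that by (rule holomorphic_derivI)
  have 1: "delta_x rank_N_star y q = euler_op f y / (1 - y) + y * f y / (1 - y)\<^sup>2" if y: "y \<in> D" for y
  proof -
    have "((\<lambda>y. f y / (1 - y)) has_field_derivative ((deriv f y * (1 - y) + f y) / ((1 - y) * (1 - y)))) (at y)"
      using D1[OF y] by (auto intro!: derivative_eq_intros fd[OF y])
    also have "(deriv f y * (1 - y) + f y) / ((1 - y) * (1 - y)) = deriv f y / (1 - y) + f y / (1 - y)\<^sup>2"
      using D1[OF y] by (simp add: add_divide_distrib power2_eq_square)
    finally have "((\<lambda>y. rank_N_star y q) has_field_derivative (deriv f y / (1 - y) + f y / (1 - y)\<^sup>2)) (at y)"
      unfolding rank_N_star_def f_def .
    from DERIV_imp_deriv[OF this] show ?thesis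
      by (simp add: delta_x_def euler_op_def algebra_simps)
  qed
  have 2: "delta_x (delta_x rank_N_star) x q = euler_op (euler_op f) x / (1 - x) + 2 * x * euler_op f x / (1 - x)\<^sup>2
      + x * (1 + x) * f x / (1 - x) ^ 3"
  proof -
    have nz: "1 - x \<noteq> 0" using D1[OF D(2)] by simp
    have e2: "euler_op (euler_op f) x = x * deriv (euler_op f) x" and e1: "euler_op f x = x * deriv f x"
      by (simp_all add: euler_op_def)
    have "((\<lambda>y. euler_op f y / (1 - y) + y * f y / (1 - y)\<^sup>2) has_field_derivative
       ((deriv (euler_op f) x * (1 - x) + euler_op f x) / (1 - x)\<^sup>2 +
        ((f x + x * deriv f x) * (1 - x)\<^sup>2 + x * f x * (2 * (1 - x))) / ((1 - x)\<^sup>2)\<^sup>2)) (at x)"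
      using nz by (auto intro!: derivative_eq_intros fd[OF D(2)] gd[OF D(2)] simp: power2_eq_square)
        (simp_all add: algebra_simps)?
    hence "((\<lambda>y. delta_x rank_N_star y q) has_field_derivative
       ((deriv (euler_op f) x * (1 - x) + euler_op f x) / (1 - x)\<^sup>2 +
        ((f x + x * deriv f x) * (1 - x)\<^sup>2 + x * f x * (2 * (1 - x))) / ((1 - x)\<^sup>2)\<^sup>2)) (at x)"
      by (rule has_field_derivative_transform_within_open[OF _ D]) (simp add: 1)
    from DERIV_imp_deriv[OF this] have "delta_x (delta_x rank_N_star) x q = x *
       ((deriv (euler_op f) x * (1 - x) + euler_op f x) / (1 - x)\<^sup>2 +
        ((f x + x * deriv f x) * (1 - x)\<^sup>2 + x * f x * (2 * (1 - x))) / ((1 - x)\<^sup>2)\<^sup>2)"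
      by (simp add: delta_x_def[of "delta_x rank_N_star"] euler_op_def)
    also have "\<dots> = euler_op (euler_op f) x / (1 - x) + 2 * x * euler_op f x / (1 - x)\<^sup>2
      + x * (1 + x) * f x / (1 - x) ^ 3"
      unfolding e2 e1 using nz
      by (simp add: divide_simps power2_eq_square power3_eq_cube) algebra
    finally show ?thesis .
  qed
  have 3: "delta_q rank_N_star x q = delta_q rank_N x q / (1 - x)"
  proof -
    have "(rank_N x has_field_derivative deriv (rank_N x) q) (at q)"
      using sep_holomorphic_at_differentiable(2)[OF hN[OF D(2)]] by (simp add: field_differentiable_derivI)
    hence "((\<lambda>s. rank_N x s / (1 - x)) has_field_derivative deriv (rank_N x) q / (1 - x)) (at q)"
      by (rule DERIV_cdivide)
    from DERIV_imp_deriv[OF this] show ?thesis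
      by (simp add: delta_q_def euler_op_def rank_N_star_def)
  qed
  have 4: "delta_x rank_N x q = euler_op f x" "delta_x (delta_x rank_N) x q = euler_op (euler_op f) x"
     "rank_N x q = f x"
    by (simp_all add: delta_x_def f_def)
  have "1 - x \<noteq> 0" using D1[OF D(2)] by simp
  thus ?thesis unfolding 1[OF D(2)] 2 3 4
    by (simp add: divide_simps power2_eq_square power3_eq_cube) algebra
qed

section \<open>The value at \<open>x = 1\<close>\<close>

text \<open>The summand is the n-th power of C r^n, so the quadratic exponent beats every geometric
  factor.\<close>

lemma summable_power_square:
  fixes r C :: real
  assumes "0 \<le> r" "r < 1" "0 \<le> C"
  shows "summable (\<lambda>n. r ^ n\<^sup>2 * C ^ n)"
proof -
  have "(\<lambda>n. C * r ^ n) \<longlonglongrightarrow> 0"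
    using assms by (intro tendsto_eq_intros LIMSEQ_realpow_zero) auto
  hence "eventually (\<lambda>n. C * r ^ n < 1/2) sequentially"
    by (rule order_tendstoD) auto
  then obtain N where N: "\<And>n. n \<ge> N \<Longrightarrow> C * r ^ n < 1/2"
    by (auto simp: eventually_sequentially)
  show ?thesis
  proof (rule summable_comparison_test'[where N = N])
    show "summable (\<lambda>n. (1/2::real) ^ n)" by (rule summable_geometric) auto
    fix n assume n: "n \<ge> N"
    have "r ^ n\<^sup>2 * C ^ n = (C * r ^ n) ^ n"
      by (simp add: power_mult_distrib power2_eq_square power_mult)
    also have "\<dots> \<le> (1/2) ^ n"
      using N[OF n] assms by (intro power_mono) auto
    finally show "norm (r ^ n\<^sup>2 * C ^ n) \<le> (1/2) ^ n" using assms by simp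
  qed
qed

text \<open>The series evaluated here is the limiting case of the \<open>q\<close>-Gauss sum; \<open>gauss_term k\<close> has lower
  parameter \<open>q\<^bsup>2k+2\<^esup>\<close>, and increasing \<open>k\<close> by one costs a factor of the product side.\<close>

definition gauss_term :: "complex \<Rightarrow> nat \<Rightarrow> nat \<Rightarrow> complex" where
  "gauss_term q k n = q ^ (n\<^sup>2 + 2 * k * n) * qfac (- q) (q\<^sup>2) n /
     (qfac (q\<^sup>2) (q\<^sup>2) n * qfac (q ^ (2 * k + 2)) (q\<^sup>2) n)"

section \<open>Majorants and recurrence for the Gauss series\<close>

lemma norm_qfac_upper:
  assumes "norm a \<le> 1" "norm p \<le> 1"
  shows "norm (qfac a p n) \<le> 2 ^ n"
proof -
  have "norm (qfac a p n) = (\<Prod>k<n. norm (1 - a * p ^ k))" by (simp add: qfac_def prod_norm)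
  also have "\<dots> \<le> (\<Prod>k<n. 2)"
  proof (rule prod_mono)
    fix k
    have "norm (a * p ^ k) \<le> 1 * 1" unfolding norm_mult norm_power using assms
      by (intro mult_mono power_le_one) auto
    thus "0 \<le> norm (1 - a * p ^ k) \<and> norm (1 - a * p ^ k) \<le> 2"
      using norm_triangle_ineq4[of 1 "a * p ^ k"] by simp
  qed
  finally show ?thesis by simp
qed

lemma norm_qfac_lower:
  assumes "norm a \<le> r" "r \<le> 1" "norm p \<le> 1"
  shows "norm (qfac a p n) \<ge> (1 - r) ^ n"
proof -
  have "(1 - r) ^ n = (\<Prod>k<n. 1 - r)" by simp
  also have "\<dots> \<le> (\<Prod>k<n. norm (1 - a * p ^ k))"
  proof (rule prod_mono)
    fix k
    have "norm (a * p ^ k) \<le> r * 1" unfolding norm_mult norm_power using assms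
      by (intro mult_mono power_le_one) (auto intro: order_trans[OF norm_ge_zero])
    thus "0 \<le> 1 - r \<and> 1 - r \<le> norm (1 - a * p ^ k)"
      using norm_triangle_ineq2[of 1 "a * p ^ k"] assms by simp
  qed
  also have "\<dots> = norm (qfac a p n)" by (simp add: qfac_def prod_norm)
  finally show ?thesis .
qed

text \<open>The dependence on k is isolated in a last factor that is at most 1 and, for n > 0, tends
  to 0 as k grows. The other factors form a summable majorant, which is what the exchange of limit
  and sum requires.\<close>

lemma gauss_term_bound:
  assumes q: "norm q < 1"
  shows "norm (gauss_term q k n) \<le> norm q ^ n\<^sup>2 * (2 / (1 - (norm q)\<^sup>2)\<^sup>2) ^ n * (norm q ^ (2 * n)) ^ k"
proof -
  define r where "r = (norm q)\<^sup>2"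
  have r: "r < 1" "0 \<le> r" using q by (auto simp: r_def power_less_one_iff)
  have "norm (q ^ (2 * k + 2)) \<le> r"
    unfolding norm_power r_def using q by (intro power_decreasing) auto
  hence "norm (qfac (q ^ (2 * k + 2)) (q\<^sup>2) n) \<ge> (1 - r) ^ n"
    using r by (intro norm_qfac_lower) (auto simp: norm_power r_def)
  moreover have "norm (qfac (q\<^sup>2) (q\<^sup>2) n) \<ge> (1 - r) ^ n"
    using r by (intro norm_qfac_lower) (auto simp: norm_power r_def)
  moreover have "norm (qfac (- q) (q\<^sup>2) n) \<le> 2 ^ n"
    using r q by (intro norm_qfac_upper) (auto simp: norm_power r_def)
  ultimately have "norm (gauss_term q k n) \<le> norm q ^ (n\<^sup>2 + 2 * k * n) * 2 ^ n / ((1 - r) ^ n * (1 - r) ^ n)"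
    unfolding gauss_term_def norm_divide norm_mult norm_power using r
    by (intro frac_le mult_mono mult_left_mono) auto
  also have "\<dots> = norm q ^ n\<^sup>2 * (2 / (1 - r)\<^sup>2) ^ n * (norm q ^ (2 * n)) ^ k"
    by (simp add: power_add power_mult power_divide power_mult_distrib power2_eq_square mult_ac flip: power_mult)
  finally show ?thesis unfolding r_def .
qed

lemma gauss_sum_shift:
  assumes q: "norm q < 1" "q \<noteq> 0"
  shows "summable (gauss_term q k)"
    "(1 - q ^ (2 * k + 2)) * (\<Sum>n. gauss_term q k n) = (1 + q ^ (2 * k + 1)) * (\<Sum>n. gauss_term q (Suc k) n)"
proof -
  define M where "M = (\<lambda>n. norm q ^ n\<^sup>2 * (2 / (1 - (norm q)\<^sup>2)\<^sup>2) ^ n)"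
  have sM: "summable M" unfolding M_def
    using q by (intro summable_power_square) auto
  have M0: "M n \<ge> 0" for n by (simp add: M_def)
  have bd: "norm (gauss_term q k n) \<le> M n" for k n
  proof -
    have "(norm q ^ (2 * n)) ^ k \<le> 1" using q by (intro power_le_one) auto
    thus ?thesis using gauss_term_bound[OF q(1), of k n] M0[of n] unfolding M_def
      by (smt (verit) mult_left_le)
  qed
  have sm: "summable (gauss_term q k)" for k
    by (rule summable_comparison_test'[OF sM, of 0]) (use bd in auto)
  thus "summable (gauss_term q k)" .
  define c where "c = q ^ (2 * k + 2)"
  \<comment> \<open>Again a certificate: the factor 1 - q^(2n) cancels the new factor of
    (q^2;q^2)_(n+1) in the next term, and it vanishes at n = 0, so the telescoped sum is 0.\<close>
  define V where "V = (\<lambda>n. - (1 - c) * (1 - (q\<^sup>2) ^ n) * gauss_term q k n)"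
  have p1: "norm (q\<^sup>2) < 1" using q by (simp add: norm_power power_less_one_iff)
  have pk: "1 - (q\<^sup>2) * (q\<^sup>2) ^ n \<noteq> 0" for n
    using power_mult_ne_1[OF p1 p1, of n] by simp
  have cp: "c = (q\<^sup>2) * (q\<^sup>2) ^ k" unfolding c_def power_add power_mult by (rule mult.commute)
  have cn: "1 - c * (q\<^sup>2) ^ n \<noteq> 0" for n
    using pk[of "k + n"] by (simp add: cp power_add mult_ac)
  have tele: "(1 - c) * gauss_term q k n - (1 + q ^ (2 * k + 1)) * gauss_term q (Suc k) n = V (Suc n) - V n" for n
  proof -
    define Q where "Q = (q\<^sup>2) ^ n"
    define a b where "a = qfac (q\<^sup>2) (q\<^sup>2) n" and "b = qfac c (q\<^sup>2) n"
    have cQ: "1 - c * Q \<noteq> 0" "1 - q\<^sup>2 * Q \<noteq> 0" "1 - c \<noteq> 0"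
      using cn[of n] pk[of n] cn[of 0] by (auto simp: Q_def)
    have cS: "q ^ (2 * Suc k + 2) = c * q\<^sup>2" by (simp add: c_def power2_eq_square mult_ac)
    have bS: "qfac (c * q\<^sup>2) (q\<^sup>2) n = b * (1 - c * Q) / (1 - c)"
      using qfac_shift[of c "q\<^sup>2" n] cQ by (simp add: b_def Q_def field_simps)
    have e1: "q ^ (n\<^sup>2 + 2 * Suc k * n) = q ^ (n\<^sup>2 + 2 * k * n) * Q"
      by (simp add: Q_def power_add power_mult algebra_simps flip: power_mult)
    have t1: "gauss_term q (Suc k) n = gauss_term q k n * (Q * (1 - c) / (1 - c * Q))"
      unfolding gauss_term_def cS e1 bS c_def[symmetric] b_def[symmetric] using cQ
      by (cases "b = 0") (simp_all add: field_simps)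
    define u where "u = q ^ (2 * k + 1)"
    have cu: "c = u * q" by (simp add: c_def u_def)
    have e2: "q ^ ((Suc n)\<^sup>2 + 2 * k * Suc n) = q ^ (n\<^sup>2 + 2 * k * n) * (u * Q)"
    proof -
      have "(Suc n)\<^sup>2 + 2 * k * Suc n = (n\<^sup>2 + 2 * k * n) + (2 * k + 1) + 2 * n"
        by (simp add: power2_eq_square)
      thus ?thesis by (simp only: power_add u_def Q_def power_mult mult.assoc)
    qed
    have t2: "gauss_term q k (Suc n) = gauss_term q k n * (u * Q * (1 + q * Q) / ((1 - q\<^sup>2 * Q) * (1 - c * Q)))"
      unfolding gauss_term_def qfac_Suc e2 c_def[symmetric] Q_def[symmetric] by (simp add: mult_ac)
    have VS: "V (Suc n) = gauss_term q k n * (- (1 - c) * (u * Q * (1 + q * Q) / (1 - c * Q)))"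
      unfolding V_def t2 using cQ by (simp add: Q_def[symmetric])
    have "(1 - c) - (1 + u) * (Q * (1 - c) / (1 - c * Q)) =
      - (1 - c) * (u * Q * (1 + q * Q) / (1 - c * Q)) + (1 - c) * (1 - Q)"
      using cQ(1) by (simp add: divide_simps) (simp add: cu algebra_simps)
    hence "gauss_term q k n * ((1 - c) - (1 + u) * (Q * (1 - c) / (1 - c * Q))) =
      gauss_term q k n * (- (1 - c) * (u * Q * (1 + q * Q) / (1 - c * Q)) + (1 - c) * (1 - Q))"
      by simp
    thus ?thesis unfolding VS t1 unfolding V_def Q_def[symmetric] u_def[symmetric]
      by (simp add: algebra_simps)
  qed
  have "V \<longlonglongrightarrow> - (1 - c) * (1 - 0) * 0"
    unfolding V_def using p1
    by (intro tendsto_intros LIMSEQ_power_zero summable_LIMSEQ_zero[OF sm])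
  hence "(\<lambda>n. V (Suc n) - V n) sums (0 - V 0)" by (intro telescope_sums) simp
  hence 1: "(\<lambda>n. V (Suc n) - V n) sums 0" by (simp add: V_def)
  have 2: "(\<lambda>n. V (Suc n) - V n) sums ((1 - c) * (\<Sum>n. gauss_term q k n) - (1 + q ^ (2 * k + 1)) * (\<Sum>n. gauss_term q (Suc k) n))"
    unfolding tele[symmetric] by (intro sums_diff sums_mult summable_sums sm)
  show "(1 - q ^ (2 * k + 2)) * (\<Sum>n. gauss_term q k n) = (1 + q ^ (2 * k + 1)) * (\<Sum>n. gauss_term q (Suc k) n)"
    using sums_unique2[OF 1 2] by (simp add: c_def)
qed

text \<open>Iterating the recurrence gives (q^2;q^2)_k S 0 = (-q;q^2)_k S k. As k grows only the
  term n = 0 of S k survives, so S k tends to 1 by Tannery's theorem and the products tend to their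
  infinite versions.\<close>

lemma rank_N_at_1:
  assumes q: "norm q < 1" "q \<noteq> 0"
  shows "rank_N 1 q = qinf (- q) (q\<^sup>2) / qinf (q\<^sup>2) (q\<^sup>2)"
proof -
  have p1: "norm (q\<^sup>2) < 1" using q by (simp add: norm_power power_less_one_iff)
  have pk: "q ^ (2 * Suc k) \<noteq> 1" for k
  proof -
    have "norm q ^ (2 * Suc k) < 1" using q by (subst power_less_one_iff) auto
    thus ?thesis by (metis less_irrefl norm_one norm_power)
  qed
  have dom: "(1, q) \<in> rank_dom" using q pk by (auto simp: rank_dom_def)
  define S where "S = (\<lambda>k. \<Sum>n. gauss_term q k n)"
  have "rank_N 1 q = S 0"
    unfolding rank_N_eq[OF dom] S_def by (simp add: rank_term_def gauss_term_def[abs_def] power2_eq_square)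
  define M where "M = (\<lambda>n. norm q ^ n\<^sup>2 * (2 / (1 - (norm q)\<^sup>2)\<^sup>2) ^ n)"
  have sM: "summable M" unfolding M_def
    using q by (intro summable_power_square) auto
  have S1: "S \<longlonglongrightarrow> 1"
  proof -
    have "(\<lambda>k. gauss_term q k n) \<longlonglongrightarrow> (if n = 0 then 1 else 0)" for n
    proof (cases "n = 0")
      case False
      have "norm q ^ (2 * n) < 1" using q False by (subst power_less_one_iff) auto
      hence "(\<lambda>k. (norm q ^ (2 * n)) ^ k) \<longlonglongrightarrow> 0" by (intro LIMSEQ_realpow_zero) auto
      hence "(\<lambda>k. M n * (norm q ^ (2 * n)) ^ k) \<longlonglongrightarrow> M n * 0" by (rule tendsto_mult_left)
      hence lim: "(\<lambda>k. M n * (norm q ^ (2 * n)) ^ k) \<longlonglongrightarrow> 0" by simp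
      have "norm (gauss_term q k n) \<le> M n * (norm q ^ (2 * n)) ^ k" for k
        using gauss_term_bound[OF q(1), of k n] by (simp only: M_def)
      hence "(\<lambda>k. gauss_term q k n) \<longlonglongrightarrow> 0"
        by (intro Lim_null_comparison[OF _ lim] always_eventually allI)
      thus ?thesis using False by simp
    qed (simp add: gauss_term_def)
    moreover have "norm (gauss_term q k n) \<le> M n" for k n
    proof -
      have "(norm q ^ (2 * n)) ^ k \<le> 1" "M n \<ge> 0" using q by (auto intro!: power_le_one simp: M_def)
      thus ?thesis using gauss_term_bound[OF q(1), of k n] unfolding M_def
        by (smt (verit) mult_left_le)
    qed
    ultimately have "S \<longlonglongrightarrow> (\<Sum>n. if n = 0 then 1 else 0)"
      unfolding S_def
      by (intro conjunct2[OF conjunct2[OF tannerys_theorem[where M = M]]] sM) (auto simp: case_prod_unfold)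
    moreover have "(\<Sum>n. if n = 0 then 1 else 0) = (1 :: complex)"
      by (rule sums_unique[symmetric], rule sums_single[of 0 "\<lambda>_. 1"])
    ultimately show ?thesis by metis
  qed
  have prod: "qfac (q\<^sup>2) (q\<^sup>2) k * S 0 = qfac (- q) (q\<^sup>2) k * S k" for k
  proof (induction k)
    case (Suc k)
    have "(1 - q\<^sup>2 * (q\<^sup>2) ^ k) * S k = (1 + q * (q\<^sup>2) ^ k) * S (Suc k)"
    proof -
      have "q\<^sup>2 * (q\<^sup>2) ^ k = q ^ (2 * k + 2)" "q * (q\<^sup>2) ^ k = q ^ (2 * k + 1)"
        unfolding power_add power_mult by simp_all
      thus ?thesis using gauss_sum_shift(2)[OF q, of k] by (simp only: S_def)
    qed
    hence "qfac (- q) (q\<^sup>2) k * ((1 - q\<^sup>2 * (q\<^sup>2) ^ k) * S k) = qfac (- q) (q\<^sup>2) k * ((1 + q * (q\<^sup>2) ^ k) * S (Suc k))"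
      by simp
    thus ?case using Suc by (simp add: qfac_Suc algebra_simps)
  qed simp
  have "(\<lambda>k. qfac (q\<^sup>2) (q\<^sup>2) k * S 0) \<longlonglongrightarrow> qinf (q\<^sup>2) (q\<^sup>2) * S 0"
    by (intro tendsto_intros qfac_LIMSEQ p1)
  moreover have "(\<lambda>k. qfac (q\<^sup>2) (q\<^sup>2) k * S 0) \<longlonglongrightarrow> qinf (- q) (q\<^sup>2) * 1"
    unfolding prod by (intro tendsto_intros qfac_LIMSEQ p1 S1)
  ultimately have "qinf (q\<^sup>2) (q\<^sup>2) * S 0 = qinf (- q) (q\<^sup>2)"
    using LIMSEQ_unique by fastforce
  moreover have "qinf (q\<^sup>2) (q\<^sup>2) \<noteq> 0" by (rule qinf_nonzero_norm[OF p1 p1])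
  ultimately show ?thesis using \<open>rank_N 1 q = S 0\<close> by (simp add: field_simps)
qed

section \<open>Uniqueness\<close>

text \<open>A function on \<open>\<complex>\<^sup>*\<close> with multiplier \<open>-q\<close> under \<open>x \<mapsto> xq\<^sup>2\<close> would, divided by a square root of
  \<open>x\<close>, have doubly periodic modulus in the logarithmic coordinate. It is then constant by the maximum
  principle, but changes sign under \<open>z \<mapsto> z + 2\<pi>i\<close>.\<close>

lemma annulus_shift_zero:
  assumes q: "norm q < 1" "q \<noteq> 0"
    and hol: "K holomorphic_on {x. (norm q)\<^sup>2 < norm x \<and> norm x < 1 / (norm q)\<^sup>2}"
    and shift: "\<And>x. 1 < norm x \<Longrightarrow> norm x < 1 / (norm q)\<^sup>2 \<Longrightarrow> K (x * q\<^sup>2) = - q * K x"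
    and x: "(norm q)\<^sup>2 < norm x" "norm x < 1 / (norm q)\<^sup>2"
  shows "K x = 0"
proof -
  define L where "L = - 2 * ln (norm q)"
  have L: "L > 0" using q by (simp add: L_def)
  have eL: "exp (- L) = (norm q)\<^sup>2" "exp L = 1 / (norm q)\<^sup>2"
  proof -
    have "exp (- L) = exp (ln (norm q)) ^ 2" by (simp add: L_def flip: exp_of_nat_mult)
    thus "exp (- L) = (norm q)\<^sup>2" using q by simp
    thus "exp L = 1 / (norm q)\<^sup>2" by (metis exp_minus inverse_eq_divide inverse_inverse_eq)
  qed
  define l where "l = Ln (q\<^sup>2)"
  have l: "exp l = q\<^sup>2" "Re l = - L"
    using q by (auto simp: l_def L_def norm_power ln_realpow)
  define S where "S = {z. - L < Re z \<and> Re z < L}"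
  define A where "A = {x::complex. (norm q)\<^sup>2 < norm x \<and> norm x < 1 / (norm q)\<^sup>2}"
  have expS: "exp z \<in> A \<longleftrightarrow> z \<in> S" for z
    unfolding A_def S_def eL(2)[symmetric] unfolding eL(1)[symmetric] by simp
  define W where "W = (\<lambda>z. K (exp z) * exp (- z / 2))"
  have nW: "norm (W z) = norm (K (exp z)) * exp (- Re z / 2)" for z
    by (simp add: W_def norm_mult)
  have S: "open S" "convex S"
  proof -
    have "S = {z. Re z > - L} \<inter> {z. Re z < L}" by (auto simp: S_def)
    thus "open S" "convex S"
      by (auto intro!: open_Int convex_Int open_halfspace_Re_gt open_halfspace_Re_lt
          convex_halfspace_Re_gt convex_halfspace_Re_lt)
  qed
  have "K holomorphic_on A" using hol by (simp only: A_def)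
  moreover have "exp ` S \<subseteq> A" using expS by blast
  moreover have "exp holomorphic_on S" by (intro holomorphic_intros)
  ultimately have "(\<lambda>z. K (exp z)) holomorphic_on S"
    using holomorphic_on_compose_gen[of exp S K A] by (simp add: o_def)
  hence WS: "W holomorphic_on S" unfolding W_def
    by (intro holomorphic_intros) auto
  have per: "norm (W (z + l)) = norm (W z)" if "0 < Re z" "Re z < L" for z
  proof -
    have "K (exp z * q\<^sup>2) = - q * K (exp z)"
      using that by (intro shift) (simp_all flip: eL(2))
    moreover have "exp (- Re (z + l) / 2) = exp (- Re z / 2) * exp (L / 2)"
      by (simp add: l exp_add [symmetric] field_simps)
    moreover have "norm q * exp (L / 2) = 1"
      using q by (simp add: L_def exp_minus)
    ultimately show ?thesis
      unfolding nW by (simp add: exp_add l norm_mult algebra_simps)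
  qed
  \<comment> \<open>Every point of S can be moved into B by l or -l and a multiple of 2 pi i, none
    of which changes the modulus of W. As S is open and twice as wide as B, the maximum over the
    compact B is a maximum over S attained at an interior point.\<close>
  define B where "B = cbox (Complex (- L / 2) 0) (Complex (L / 2) (2 * pi))"
  have BS: "B \<subseteq> S" using L by (auto simp: B_def S_def in_cbox_complex_iff)
  have "continuous_on B (\<lambda>z. norm (W z))"
    using holomorphic_on_imp_continuous_on[OF WS] BS
    by (intro continuous_intros) (auto intro: continuous_on_subset)
  moreover have "compact B" "B \<noteq> {}" using L by (auto simp: B_def box_ne_empty Basis_complex_def)
  ultimately obtain \<xi> where \<xi>: "\<xi> \<in> B" "\<And>z. z \<in> B \<Longrightarrow> norm (W z) \<le> norm (W \<xi>)"
    using continuous_attains_sup[of B "\<lambda>z. norm (W z)"] by auto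
  have bnd1: "norm (W z) \<le> norm (W \<xi>)" if z: "- L / 2 \<le> Re z" "Re z \<le> L / 2" for z
  proof -
    define n where "n = \<lfloor>Im z / (2 * pi)\<rfloor>"
    define z' where "z' = z - 2 * of_int n * of_real pi * \<i>"
    have "of_int n \<le> Im z / (2 * pi)" "Im z / (2 * pi) < of_int n + 1" by (simp_all add: n_def)
    hence "z' \<in> B" using z by (simp add: z'_def B_def in_cbox_complex_iff field_simps)
    moreover have "exp z' = exp z" unfolding z'_def exp_diff
      by (simp add: exp_integer_2pi[of "of_int n", simplified] mult_ac)
    hence "norm (W z') = norm (W z)" by (simp add: nW z'_def)
    ultimately show ?thesis using \<xi>(2) by metis
  qed
  have bnd: "norm (W z) \<le> norm (W \<xi>)" if z: "z \<in> S" for z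
  proof -
    consider "- L / 2 \<le> Re z \<and> Re z \<le> L / 2" | "Re z > L / 2" | "Re z < - L / 2" by linarith
    thus ?thesis
    proof cases
      case 2
      hence "norm (W (z + l)) = norm (W z)" using z L by (intro per) (auto simp: S_def)
      moreover have "norm (W (z + l)) \<le> norm (W \<xi>)"
        using 2 z by (intro bnd1) (auto simp: S_def l)
      ultimately show ?thesis by simp
    next
      case 3
      have "norm (W (z - l + l)) = norm (W (z - l))" using z 3 L by (intro per) (auto simp: S_def l)
      moreover have "norm (W (z - l)) \<le> norm (W \<xi>)"
        using 3 z by (intro bnd1) (auto simp: S_def l)
      ultimately show ?thesis by simp
    qed (auto intro: bnd1)
  qed
  have "W constant_on S"
    using maximum_modulus_principle[OF WS S(1) convex_connected[OF S(2)] S(1) order_refl, of \<xi>] \<xi>(1) BS bnd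
    by blast
  then obtain c where c: "\<And>z. z \<in> S \<Longrightarrow> W z = c" by (auto simp: constant_on_def)
  have "W (2 * pi * \<i>) = - W 0"
  proof -
    have "exp (- (2 * of_real pi * \<i>) / 2) = (-1 :: complex)" by (simp add: exp_minus)
    thus ?thesis by (simp add: W_def)
  qed
  moreover have "W (2 * pi * \<i>) = c" "W 0 = c" using L by (auto intro!: c simp: S_def)
  ultimately have "c = 0" by simp
  have "x \<noteq> 0" using x q by auto
  hence "exp (Ln x) = x" by simp
  moreover have "Ln x \<in> S" using expS[of "Ln x"] x \<open>x \<noteq> 0\<close> by (simp add: A_def)
  ultimately show "K x = 0" using c[of "Ln x"] \<open>c = 0\<close> by (simp add: W_def)
qed

section \<open>The identity\<close>

text \<open>The shift moves one linear factor from the first product to the second, and 1 - 1/x =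
  -(1 - x)/x. The factor 1 - x is kept apart from (x;p)_inf because it carries the zero at x =
  1.\<close>

lemma theta_quasiperiod:
  assumes "norm p < 1" "p \<noteq> 0" "x \<noteq> 0"
  shows "(1 - x * p) * qinf (x * p * p) p * qinf (p / (x * p)) p = - ((1 - x) * qinf (x * p) p * qinf (p / x) p) / x"
proof -
  have "qinf (1 / x) p = (1 - 1 / x) * qinf (p / x) p"
    using qinf_head[OF assms(1), of "1 / x"] by simp
  moreover have "p / (x * p) = 1 / x" using assms by simp
  moreover have "(1 - x * p) * qinf (x * p * p) p = qinf (x * p) p"
    using qinf_head[OF assms(1), of "x * p"] by simp
  ultimately have "(1 - x * p) * qinf (x * p * p) p * qinf (p / (x * p)) p =
      (1 - 1 / x) * (qinf (x * p) p * qinf (p / x) p)"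
    by simp
  also have "1 - 1 / x = - (1 - x) / x" using assms by (simp add: field_simps)
  finally show ?thesis
    by (simp only: minus_mult_left[symmetric] times_divide_eq_left mult.assoc)
qed

lemma theta_numerator_quasiperiod:
  assumes "norm q < 1" "q \<noteq> 0" "x \<noteq> 0"
  shows "qinf (- (x * q\<^sup>2 * q)) (q\<^sup>2) * qinf (- q / (x * q\<^sup>2)) (q\<^sup>2) =
    qinf (- (x * q)) (q\<^sup>2) * qinf (- q / x) (q\<^sup>2) / (x * q)"
proof -
  have p: "norm (q\<^sup>2) < 1" using assms by (simp add: norm_power power_less_one_iff)
  have 1: "qinf (- q / (x * q\<^sup>2)) (q\<^sup>2) = (1 + 1 / (x * q)) * qinf (- q / x) (q\<^sup>2)"
  proof -
    have e: "- q / (x * q\<^sup>2) * q\<^sup>2 = - q / x" "1 - - q / (x * q\<^sup>2) = 1 + 1 / (x * q)"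
      using assms by (simp_all add: power2_eq_square)
    show ?thesis using qinf_head[OF p, of "- q / (x * q\<^sup>2)"] unfolding e .
  qed
  have 2: "qinf (- (x * q)) (q\<^sup>2) = (1 + x * q) * qinf (- (x * q\<^sup>2 * q)) (q\<^sup>2)"
    using qinf_head[OF p, of "- (x * q)"] by (simp add: mult_ac)
  have "1 + 1 / (x * q) = (1 + x * q) / (x * q)" using assms by (simp add: field_simps)
  thus ?thesis unfolding 1 2 by simp
qed

section \<open>The two sides of the identity for a fixed nonzero q\<close>

context
  fixes q :: complex
  assumes q1: "norm q < 1" and q0: "q \<noteq> 0"
begin

text \<open>The radii are the moduli of q^2 and q^(-2), so 1 is the only even power of q inside,
  while every orbit of x -> xq^2 on the punctured plane meets the annulus.\<close>

abbreviation "annulus \<equiv> {x::complex. (norm q)\<^sup>2 < norm x \<and> norm x < 1 / (norm q)\<^sup>2}"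

definition "pde_rank x = 2 * delta_q rank_N_star x q + delta_x rank_N_star x q + delta_x (delta_x rank_N_star) x q"

text \<open>The primed functions are the unprimed ones times (1 - x)^3 with the pole cancelled, so
  that they make sense at x = 1.\<close>

definition "pde_rank' x = 2 * (1 - x)\<^sup>2 * delta_q rank_N x q + (1 + x) * (1 - x) * delta_x rank_N x q
              + 2 * x * rank_N x q + (1 - x)\<^sup>2 * delta_x (delta_x rank_N) x q"

definition "crank_side x = 2 * x * ((qinf (q\<^sup>2) (q\<^sup>2))\<^sup>2 / qinf (- q) (q\<^sup>2))
   * (qinf (q\<^sup>2) (q\<^sup>2) / ((1 - x) * qinf (x * q\<^sup>2) (q\<^sup>2) * qinf (q\<^sup>2 / x) (q\<^sup>2))) ^ 3
   * (qinf (- (x * q)) (q\<^sup>2) * qinf (- q / x) (q\<^sup>2))"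

definition "crank_side' x = 2 * x * ((qinf (q\<^sup>2) (q\<^sup>2))\<^sup>2 / qinf (- q) (q\<^sup>2))
   * (qinf (q\<^sup>2) (q\<^sup>2) / (qinf (x * q\<^sup>2) (q\<^sup>2) * qinf (q\<^sup>2 / x) (q\<^sup>2))) ^ 3
   * (qinf (- (x * q)) (q\<^sup>2) * qinf (- q / x) (q\<^sup>2))"

lemma p1: "norm (q\<^sup>2) < 1"
  using q1 by (simp add: norm_power power_less_one_iff)

text \<open>The prefactor x contributes q^2, the cubed theta function in the denominator -x^3, and
  the numerator theta function 1/(xq); the product is -q x^2.\<close>

lemma crank_side_shift:
  assumes "x \<noteq> 0"
  shows "crank_side (x * q\<^sup>2) = - q * x\<^sup>2 * crank_side x"
proof -
  have cube: "(c / (- T / x)) ^ 3 = - (x ^ 3) * (c / T) ^ 3" for c T :: complex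
    by (cases "T = 0") (use assms in \<open>simp_all add: power_divide power_mult_distrib divide_simps\<close>)
  have "q\<^sup>2 \<noteq> 0" using q0 by simp
  note th = theta_quasiperiod[OF p1 this assms]
  have "2 * (x * q\<^sup>2) * A * (- (x ^ 3) * B) * (J / (x * q)) = - q * x\<^sup>2 * (2 * x * A * B * J)" for A B J :: complex
    using assms q0 by (simp add: power2_eq_square power3_eq_cube)
  thus ?thesis
    unfolding crank_side_def th theta_numerator_quasiperiod[OF q1 q0 assms] cube by blast
qed

lemma crank_side_star:
  assumes "x \<noteq> 1"
  shows "crank_side' x = (1 - x) ^ 3 * crank_side x"
proof -
  have "(c / (a * b)) ^ 3 = (1 - x) ^ 3 * (c / ((1 - x) * a * b)) ^ 3" for a b c :: complex
    using assms by (simp add: power_mult_distrib power_divide)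
  note this[of "qinf (q\<^sup>2) (q\<^sup>2)" "qinf (x * q\<^sup>2) (q\<^sup>2)" "qinf (q\<^sup>2 / x) (q\<^sup>2)"]
  thus ?thesis unfolding crank_side_def crank_side'_def by simp
qed

lemma annulus_rank_dom:
  assumes "x \<in> annulus"
  shows "(x, q) \<in> rank_dom"
proof -
  have x: "norm x > 0" "norm x * (norm q)\<^sup>2 < 1" "(norm q)\<^sup>2 < norm x"
    using assms q0 by (auto simp: field_simps)
  have le: "norm q ^ (2 * Suc k) \<le> (norm q)\<^sup>2" for k
    using q1 by (intro power_decreasing) auto
  have "x * q ^ (2 * Suc k) \<noteq> 1 \<and> q ^ (2 * Suc k) / x \<noteq> 1" for k
  proof -
    have "norm (x * q ^ (2 * Suc k)) \<le> norm x * (norm q)\<^sup>2"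
      unfolding norm_mult norm_power using le by (intro mult_left_mono) auto
    hence 1: "norm (x * q ^ (2 * Suc k)) < 1" using x by linarith
    have "norm (q ^ (2 * Suc k)) < norm x"
      unfolding norm_power using le[of k] x by linarith
    hence 2: "norm (q ^ (2 * Suc k) / x) < 1" using x by (simp add: norm_divide divide_less_eq)
    show ?thesis using 1 2 by (metis less_irrefl norm_one)
  qed
  thus ?thesis using x q1 by (auto simp: rank_dom_def simp del: mult_Suc_right power_Suc)
qed

lemma qinf_ne_0_rank_dom:
  assumes "(x, q) \<in> rank_dom"
  shows "qinf (x * q\<^sup>2) (q\<^sup>2) \<noteq> 0" "qinf (q\<^sup>2 / x) (q\<^sup>2) \<noteq> 0"
proof -
  have "q\<^sup>2 * (q\<^sup>2) ^ k = q ^ (2 * Suc k)" for k by (simp only: power_mult power_Suc)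
  thus "qinf (x * q\<^sup>2) (q\<^sup>2) \<noteq> 0" "qinf (q\<^sup>2 / x) (q\<^sup>2) \<noteq> 0"
    using rank_domD(3,4)[OF assms]
    by (intro qinf_nonzero[OF p1]; simp only: mult.assoc times_divide_eq_left eq_iff_diff_eq_0[of _ 1]; force)+
qed

lemma open_annulus: "open annulus"
proof -
  have "annulus = {x. (norm q)\<^sup>2 < norm x} \<inter> {x. norm x < 1 / (norm q)\<^sup>2}" by auto
  also have "open \<dots>" by (intro open_Int open_Collect_less continuous_intros)
  finally show ?thesis .
qed

text \<open>The x-derivatives of N are holomorphic at once; for x -> delta_q N this rests on the
  two-variable bound behind \<open>sep_holomorphic_at\<close>.\<close>

lemma holomorphic_pde_rank': "pde_rank' holomorphic_on annulus"
proof -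
  have h: "sep_holomorphic_at rank_N x q" if "x \<in> annulus" for x
    using that by (intro sep_holomorphic_at_rank_N annulus_rank_dom)
  have "(\<lambda>x. rank_N x q) holomorphic_on annulus" "(\<lambda>x. deriv (rank_N x) q) holomorphic_on annulus"
    by (intro sep_holomorphic_at_holomorphic_x sep_holomorphic_at_deriv_holomorphic_on h open_annulus; assumption)+
  thus ?thesis
    unfolding pde_rank'_def[abs_def] delta_x_def delta_q_def euler_op_def
    by (intro holomorphic_intros holomorphic_deriv open_annulus) auto
qed

lemma holomorphic_crank_side': "crank_side' holomorphic_on annulus"
proof -
  have "x \<noteq> 0" if "x \<in> annulus" for x
    using rank_domD(2)[OF annulus_rank_dom[OF that]] .
  moreover have "qinf (- q) (q\<^sup>2) \<noteq> 0"
    using p1 q1 by (intro qinf_nonzero_norm) auto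
  ultimately show ?thesis
    unfolding crank_side'_def[abs_def]
    using qinf_ne_0_rank_dom[OF annulus_rank_dom]
    by (intro holomorphic_intros p1) auto
qed

text \<open>All derivatives carry a factor 1 - x, so the left-hand side is 2N(1). On the right the
  products collapse to 2(-q;q^2)_inf/(q^2;q^2)_inf, which is the same by the Gauss
  evaluation.\<close>

lemma sides_at_1: "pde_rank' 1 = crank_side' 1"
proof -
  have "qinf (- q) (q\<^sup>2) \<noteq> 0" "qinf (q\<^sup>2) (q\<^sup>2) \<noteq> 0"
    using p1 q1 by (simp_all add: qinf_nonzero_norm)
  thus ?thesis
    by (simp add: pde_rank'_def crank_side'_def rank_N_at_1[OF q1 q0] power2_eq_square power3_eq_cube)
qed

lemma star_diff_shift:
  assumes "(x, q) \<in> star_dom"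
  shows "pde_rank (x * q\<^sup>2) - crank_side (x * q\<^sup>2) = - q * x\<^sup>2 * (pde_rank x - crank_side x)"
proof -
  have "x \<noteq> 0" using assms by (simp add: star_dom_iff)
  thus ?thesis
    using rank_pde_shift[OF assms q0] crank_side_shift[of x]
    by (simp add: pde_rank_def right_diff_distrib)
qed

lemma star_diff_unstar:
  assumes "(x, q) \<in> star_dom"
  shows "pde_rank' x - crank_side' x = (1 - x) ^ 3 * (pde_rank x - crank_side x)"
  using rank_pde_star[OF assms] crank_side_star[of x] assms
  by (simp add: pde_rank_def pde_rank'_def right_diff_distrib star_dom_def)

text \<open>The difference of the two sides vanishes at \<open>x = 1\<close>, so its quotient by \<open>(1 - x)\<^sup>3\<close> has at
  most a double pole there; multiplying it by the square of \<open>(x, q\<^sup>2/x; q\<^sup>2)\<^sub>\<infinity>\<close> gives a holomorphic function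
  with constant multiplier \<open>-q\<close>.\<close>

lemma sides_eq_annulus:
  assumes x: "x \<in> annulus"
  shows "pde_rank' x = crank_side' x"
proof (cases "x = 1")
  case False
  define E where "E = (\<lambda>x. pde_rank' x - crank_side' x)"
  define P where "P = (\<lambda>x. qinf (x * q\<^sup>2) (q\<^sup>2) * qinf (q\<^sup>2 / x) (q\<^sup>2))"
  \<comment> \<open>E is (1 - x)^3 times the difference of the starred sides. Dividing by x - 1
    leaves -(1 - x)^2 times that difference, and (1 - x)^2 P^2 is the squared theta function. Since
    E 1 = 0, the quotient is E x/(x - 1), made holomorphic at 1 by its limit, the derivative of
    E.\<close>
  define K where "K = (\<lambda>x. (if x = 1 then deriv E 1 else (E x - E 1) / (x - 1)) * (P x)\<^sup>2)"
  have E1: "E 1 = 0" by (simp add: E_def sides_at_1)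
  have nz: "y \<noteq> 0" if "y \<in> annulus" for y
    using rank_domD(2)[OF annulus_rank_dom[OF that]] .
  have "E holomorphic_on annulus" unfolding E_def
    by (intro holomorphic_intros holomorphic_pde_rank' holomorphic_crank_side')
  moreover have "P holomorphic_on annulus" unfolding P_def using nz
    by (intro holomorphic_intros p1) auto
  ultimately have Kh: "K holomorphic_on annulus" unfolding K_def
    by (intro holomorphic_intros pole_lemma_open open_annulus)
  have star: "(y, q) \<in> star_dom" if "y \<in> annulus" "y \<noteq> 1" for y
    using annulus_rank_dom[OF that(1)] that(2) by (simp add: star_dom_def)
  have K: "K y = - (pde_rank y - crank_side y) * ((1 - y) * P y)\<^sup>2" if "(y, q) \<in> star_dom" for y
  proof -
    have y: "y \<noteq> 1" using that by (simp add: star_dom_def)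
    have "a ^ 3 * d / (- a) * b\<^sup>2 = - d * (a * b)\<^sup>2" if "a \<noteq> 0" for a b d :: complex
      using that by (simp add: power2_eq_square power3_eq_cube)
    from this[of "1 - y" "pde_rank y - crank_side y" "P y"]
    have "(1 - y) ^ 3 * (pde_rank y - crank_side y) / (y - 1) * (P y)\<^sup>2 =
        - (pde_rank y - crank_side y) * ((1 - y) * P y)\<^sup>2"
      using y by simp
    moreover have "K y = E y / (y - 1) * (P y)\<^sup>2" using y by (simp add: K_def E1)
    ultimately show ?thesis unfolding E_def star_diff_unstar[OF that] by simp
  qed
  have "K x = 0"
  proof (rule annulus_shift_zero[OF q1 q0 Kh])
    fix y :: complex assume y: "1 < norm y" "norm y < 1 / (norm q)\<^sup>2"
    have "(norm q)\<^sup>2 < 1" using q1 by (simp add: power_less_one_iff)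
    hence ya: "y \<in> annulus" using y by simp
    hence st: "(y, q) \<in> star_dom" using y by (intro star) auto
    hence st': "(y * q\<^sup>2, q) \<in> star_dom" using q0 by (simp add: star_dom_shift)
    have "q\<^sup>2 \<noteq> 0" using q0 by simp
    hence th: "(1 - y * q\<^sup>2) * P (y * q\<^sup>2) = - ((1 - y) * P y) / y"
      using theta_quasiperiod[OF p1 _ nz[OF ya]] by (simp add: P_def mult.assoc)
    have "- (- q * y\<^sup>2 * d) * (- t / y)\<^sup>2 = - q * (- d * t\<^sup>2)" for d t
      using nz[OF ya] by (simp add: power2_eq_square)
    thus "K (y * q\<^sup>2) = - q * K y"
      unfolding K[OF st] K[OF st'] star_diff_shift[OF st] th by blast
  qed (use x in auto)
  moreover have "P x \<noteq> 0"
    using qinf_ne_0_rank_dom[OF annulus_rank_dom[OF x]] by (simp add: P_def)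
  ultimately show ?thesis using False E1 by (simp add: K_def E_def)
qed (simp add: sides_at_1)

text \<open>Both sides have the same nonzero multiplier, so equality at x and at xq^2 are
  equivalent. The induction widens the annulus by a factor |q|^2 at each end: a point with too large
  a modulus is moved by xq^2, one with too small a modulus by x/q^2.\<close>

lemma star_sides_eq:
  assumes "(x, q) \<in> star_dom"
  shows "pde_rank x = crank_side x"
proof -
  define r where "r = (norm q)\<^sup>2"
  have r: "0 < r" "r < 1" using q1 q0 by (auto simp: r_def power_less_one_iff)
  have nr: "norm (q\<^sup>2) = r" by (simp add: r_def norm_power)
  have main: "pde_rank x = crank_side x"
    if "(x, q) \<in> star_dom" "r ^ Suc n < norm x" "norm x * r ^ Suc n < 1" for n x
    using that
  proof (induction n arbitrary: x)
    case 0
    have "x \<in> annulus" using 0 r by (simp add: field_simps flip: r_def)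
    hence "(1 - x) ^ 3 * (pde_rank x - crank_side x) = 0"
      using star_diff_unstar[OF 0(1)] sides_eq_annulus[of x] by simp
    thus ?case using 0(1) by (simp add: star_dom_def)
  next
    case (Suc n)
    have x0: "x \<noteq> 0" using Suc.prems(1) by (simp add: star_dom_iff)
    have rn: "0 < r ^ Suc n" "r ^ Suc n < 1" "0 < r ^ n" "r ^ n \<le> 1"
      using r power_Suc_less_one[of r n] power_le_one[of r n] by simp_all
    consider "r ^ Suc n < norm x \<and> norm x * r ^ Suc n < 1" | "norm x * r ^ Suc n \<ge> 1" | "norm x \<le> r ^ Suc n"
      by linarith
    thus ?case
    proof cases
      case 1
      thus ?thesis using Suc by blast
    next
      case 2
      have "pde_rank (x * q\<^sup>2) = crank_side (x * q\<^sup>2)"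
      proof (rule Suc.IH)
        show "(x * q\<^sup>2, q) \<in> star_dom" using Suc.prems(1) q0 by (simp add: star_dom_shift)
        have "1 * 1 \<le> (norm x * r ^ Suc n) * (1 / r ^ n)"
          using 2 rn by (intro mult_mono) (auto simp del: power_Suc)
        hence "1 \<le> norm (x * q\<^sup>2)" using r by (simp add: norm_mult nr)
        thus "r ^ Suc n < norm (x * q\<^sup>2)" using rn by linarith
        show "norm (x * q\<^sup>2) * r ^ Suc n < 1" using Suc.prems(3) unfolding norm_mult nr by (simp add: mult_ac)
      qed
      hence "- q * x\<^sup>2 * (pde_rank x - crank_side x) = 0"
        using star_diff_shift[OF Suc.prems(1)] by simp
      thus ?thesis using q0 x0 by simp
    next
      case 3
      define y where "y = x / q\<^sup>2"
      have xy: "x = y * q\<^sup>2" using q0 by (simp add: y_def)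
      have st: "(y, q) \<in> star_dom" using Suc.prems(1) q0 unfolding xy by (simp add: star_dom_shift)
      have ny: "norm x = norm y * r" unfolding xy norm_mult nr ..
      have "pde_rank y = crank_side y"
      proof (rule Suc.IH[OF st])
        show "r ^ Suc n < norm y" using Suc.prems(2) r unfolding ny by simp
        have "norm y \<le> r ^ n" using 3 r unfolding ny by simp
        hence "norm y \<le> 1" using rn by linarith
        hence "norm y * r ^ Suc n \<le> 1 * r ^ Suc n" using rn by (intro mult_right_mono) auto
        thus "norm y * r ^ Suc n < 1" using rn by linarith
      qed
      thus ?thesis using star_diff_shift[OF st] unfolding xy by simp
    qed
  qed
  have x0: "x \<noteq> 0" using assms by (simp add: star_dom_iff)
  have "(\<lambda>n. r ^ Suc n) \<longlonglongrightarrow> 0" using r by (intro LIMSEQ_Suc LIMSEQ_realpow_zero) auto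
  hence "eventually (\<lambda>n. r ^ Suc n < min (norm x) (1 / norm x)) sequentially"
    using x0 by (intro order_tendstoD) auto
  then obtain n where "r ^ Suc n < min (norm x) (1 / norm x)" by (auto simp: eventually_sequentially)
  hence "r ^ Suc n < norm x" "norm x * r ^ Suc n < 1"
    using x0 by (auto simp: field_simps)
  thus ?thesis using main assms by blast
qed

lemma sides_eq:
  assumes "(x, q) \<in> rank_dom"
  shows "pde_rank' x = crank_side' x"
proof (cases "x = 1")
  case False
  hence "(x, q) \<in> star_dom" using assms by (simp add: star_dom_def)
  thus ?thesis using star_diff_unstar[of x] star_sides_eq[of x] by simp
qed (simp add: sides_at_1)

end

section \<open>The degenerate value q = 0 and the return to the original notation\<close>

lemma rank_N_0:
  assumes "x \<noteq> 0"
  shows "rank_N x 0 = 1"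
proof -
  have "(\<lambda>n. rank_term n x 0) sums (\<Sum>n\<in>{0}. rank_term n x 0)"
    by (rule sums_finite) (auto simp: rank_term_def)
  moreover have "(x, 0) \<in> rank_dom" using assms by (simp add: rank_dom_def)
  ultimately show ?thesis by (simp add: rank_N_eq sums_iff)
qed

text \<open>At q = 0 the shift x -> xq^2 collapses to 0 and the preceding argument is void. There N
  is constantly 1, all products are 1, and both sides equal 2x.\<close>

lemma crank_identity:
  assumes d: "(x, q) \<in> rank_dom"
  shows "2 * x * ((qpoch_inf [q\<^sup>2] (q\<^sup>2))\<^sup>2 / qpoch_inf [- q] (q\<^sup>2))
              * (crank_C x (q\<^sup>2)) ^ 3 * theta_J (- (x * q)) (q\<^sup>2)
            = 2 * (1 - x)\<^sup>2 * delta_q rank_N x q + (1 + x) * (1 - x) * delta_x rank_N x q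
              + 2 * x * rank_N x q + (1 - x)\<^sup>2 * delta_x (delta_x rank_N) x q"
proof (cases "q = 0")
  case True
  have x: "x \<noteq> 0" using rank_domD(2)[OF d] .
  have dx: "delta_x rank_N y 0 = 0" if "y \<noteq> 0" for y
  proof -
    have "((\<lambda>y. rank_N y 0) has_field_derivative 0) (at y)"
      by (rule has_field_derivative_transform_within_open[of "\<lambda>_. 1" _ _ "- {0}"])
         (use that in \<open>auto simp: rank_N_0\<close>)
    thus ?thesis by (simp add: delta_x_def euler_op_def DERIV_imp_deriv)
  qed
  have "((\<lambda>y. delta_x rank_N y 0) has_field_derivative 0) (at x)"
    by (rule has_field_derivative_transform_within_open[of "\<lambda>_. 0" _ _ "- {0}"])
       (use x in \<open>auto simp: dx\<close>)
  hence "delta_x (delta_x rank_N) x 0 = 0"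
    by (simp add: delta_x_def[of "delta_x rank_N"] euler_op_def DERIV_imp_deriv)
  moreover have "delta_q rank_N x 0 = 0" by (simp add: delta_q_def euler_op_def)
  ultimately show ?thesis using True x
    by (simp add: dx rank_N_0 crank_C_def theta_J_def qpoch_inf_def)
next
  case False
  have q1: "norm q < 1" using rank_domD(1)[OF d] .
  have p: "norm (q\<^sup>2) < 1" using q1 by (simp add: norm_power power_less_one_iff)
  have "q\<^sup>2 / - (x * q) = - q / x" using False by (simp add: power2_eq_square)
  thus ?thesis
    using sides_eq[OF q1 False d]
    unfolding pde_rank'_def[OF q1 False] crank_side'_def[OF q1 False]
    by (simp add: crank_C_def theta_J_def qpoch_inf_single qpoch_inf_pair[OF p])
qed

theorem theorem6p5:
  fixes x q :: complex
  assumes "norm q < 1"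
    and "x \<noteq> 0"
    and "\<And>n::nat. n \<ge> 1 \<Longrightarrow> x * q ^ (2 * n) \<noteq> 1"
    and "\<And>n::nat. n \<ge> 1 \<Longrightarrow> x \<noteq> q ^ (2 * n)"
  shows "(x \<noteq> 1 \<longrightarrow>
            2 * x * ((qpoch_inf [q\<^sup>2] (q\<^sup>2))\<^sup>2 / qpoch_inf [- q] (q\<^sup>2))
              * (crank_C_star x (q\<^sup>2)) ^ 3 * theta_J (- (x * q)) (q\<^sup>2)
            = 2 * delta_q rank_N_star x q + delta_x rank_N_star x q
              + delta_x (delta_x rank_N_star) x q)
       \<and> 2 * x * ((qpoch_inf [q\<^sup>2] (q\<^sup>2))\<^sup>2 / qpoch_inf [- q] (q\<^sup>2))
              * (crank_C x (q\<^sup>2)) ^ 3 * theta_J (- (x * q)) (q\<^sup>2)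
            = 2 * (1 - x)\<^sup>2 * delta_q rank_N x q + (1 + x) * (1 - x) * delta_x rank_N x q
              + 2 * x * rank_N x q + (1 - x)\<^sup>2 * delta_x (delta_x rank_N) x q"
proof (intro conjI impI)
  have "x * q ^ (2 * Suc k) \<noteq> 1 \<and> q ^ (2 * Suc k) / x \<noteq> 1" for k
    using assms(2) assms(3,4)[of "Suc k"] by (auto simp del: mult_Suc_right power_Suc)
  hence d: "(x, q) \<in> rank_dom"
    using assms(1,2) by (auto simp: rank_dom_def simp del: mult_Suc_right power_Suc)
  show *: "2 * x * ((qpoch_inf [q\<^sup>2] (q\<^sup>2))\<^sup>2 / qpoch_inf [- q] (q\<^sup>2))
              * (crank_C x (q\<^sup>2)) ^ 3 * theta_J (- (x * q)) (q\<^sup>2)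
            = 2 * (1 - x)\<^sup>2 * delta_q rank_N x q + (1 + x) * (1 - x) * delta_x rank_N x q
              + 2 * x * rank_N x q + (1 - x)\<^sup>2 * delta_x (delta_x rank_N) x q"
    using d by (rule crank_identity)
  assume x: "x \<noteq> 1"
  hence st: "(x, q) \<in> star_dom" using d by (simp add: star_dom_def)
  have C: "crank_C x (q\<^sup>2) ^ 3 = (1 - x) ^ 3 * crank_C_star x (q\<^sup>2) ^ 3"
    using x by (simp add: crank_C_star_def power_divide)
  have nz: "(1 - x) ^ 3 \<noteq> 0" using x by simp
  \<comment> \<open>The starred identity is the unstarred one divided by (1 - x)^3, on the crank
    side by definition of C* and on the rank side by the product rule. This route covers q = 0 as
    well.\<close>
  have "(1 - x) ^ 3 * (2 * x * ((qpoch_inf [q\<^sup>2] (q\<^sup>2))\<^sup>2 / qpoch_inf [- q] (q\<^sup>2))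
              * (crank_C_star x (q\<^sup>2)) ^ 3 * theta_J (- (x * q)) (q\<^sup>2)) =
      2 * x * ((qpoch_inf [q\<^sup>2] (q\<^sup>2))\<^sup>2 / qpoch_inf [- q] (q\<^sup>2))
              * (crank_C x (q\<^sup>2)) ^ 3 * theta_J (- (x * q)) (q\<^sup>2)"
    unfolding C by (simp only: mult_ac)
  also note *
  also note rank_pde_star[OF st, symmetric]
  finally show "2 * x * ((qpoch_inf [q\<^sup>2] (q\<^sup>2))\<^sup>2 / qpoch_inf [- q] (q\<^sup>2))
              * (crank_C_star x (q\<^sup>2)) ^ 3 * theta_J (- (x * q)) (q\<^sup>2)
            = 2 * delta_q rank_N_star x q + delta_x rank_N_star x q
              + delta_x (delta_x rank_N_star) x q"
    by (rule mult_left_cancel[OF nz, THEN iffD1])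
qed

end
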